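(* Let $\beta=\frac{1+\sqrt5}{2}$. For $\nu_\beta$-almost every $x\in I_\beta$, the frequency of the digit $1$ in the greedy $\beta$-expansion $(x_n)_{n\ge1}$ of $x$, that is $\lim_{n\to\infty}\frac1n\sum_{k=1}^n x_k$, exists and is equal to $\frac{5}{18}$; moreover $\frac{5}{18}>\alpha(1)$.
   Context: $\beta=\frac{1+\sqrt5}{2}$ is the golden mean and $I_\beta=[0,\frac1{\beta-1}]$. Let $\Sigma=\{0,1\}^{\mathbb N}$ (indices $n\ge 1$), let $m$ be the $(\frac12,\frac12)$ Bernoulli (product) measure on $\Sigma$, and let $\pi:\Sigma\to I_\beta$, $\pi(\underline a)=\sum_{i=1}^\infty a_i\beta^{-i}$. The Bernoulli convolution is the pushforward probability measure $\nu_\beta=m\circ\pi^{-1}$ on $I_\beta$. The greedy $\beta$-transformation $T:I_\beta\to I_\beta$ is $T(x)=\beta x$ for $x\in[0,\frac1\beta)$ and $T(x)=\beta x-1$ for $x\in[\frac1\beta,\frac1{\beta-1}]$. The greedy $\beta$-expansion of $x\in I_\beta$ is the sequence $(x_n)_{n\ge1}\in\Sigma$ with $x_n=0$ if $T^{n-1}(x)\in[0,\frac1\beta)$ and $x_n=1$ if $T^{n-1}(x)\in[\frac1\beta,\frac1{\beta-1}]$; it satisfies $\sum_{n\ge1}x_n\beta^{-n}=x$. The constant $\alpha(1)=\mu[\frac1\beta,1]=\frac1{\beta^2+1}\approx0.27639$, where $\mu$ is the $T$-invariant absolutely continuous probability measure, is the frequency of the digit $1$ in the greedy $\beta$-expansion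 of Lebesgue almost every $x\in I_\beta$. *)

theory Defs
  imports "HOL-Probability.Probability"
begin

definition \<beta> :: real where
  "\<beta> = (1 + sqrt 5) / 2"

definition I\<^sub>\<beta> :: "real set" where
  "I\<^sub>\<beta> = {0 .. 1 / (\<beta> - 1)}"

text \<open>The measure space carried by \<open>I\<^sub>\<beta>\<close> is equipped with the Borel sets of \<open>I\<^sub>\<beta>\<close>,
  so that "almost every \<open>x\<close>" below ranges over points of \<open>I\<^sub>\<beta>\<close> only.\<close>

abbreviation borel_I\<^sub>\<beta> :: "real measure" where
  "borel_I\<^sub>\<beta> \<equiv> restrict_space borel I\<^sub>\<beta>"

text \<open>The underlying space is \<open>{1..} \<rightarrow>\<^sub>E {0, 1}\<close>: digit sequences are indexed from 1
  (and are \<open>undefined\<close> at index 0).\<close>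

definition coin_measure :: "(nat \<Rightarrow> nat) measure" where
  "coin_measure = (\<Pi>\<^sub>M n\<in>{1..}. uniform_count_measure {0, 1})"

definition expansion_value :: "(nat \<Rightarrow> nat) \<Rightarrow> real" where
  "expansion_value a = (\<Sum>i. real (a (Suc i)) / \<beta> ^ Suc i)"

definition bernoulli_convolution :: "real measure" where
  "bernoulli_convolution = distr coin_measure borel_I\<^sub>\<beta> expansion_value"

text \<open>On \<open>I\<^sub>\<beta>\<close>, which it maps to itself, this is the greedy \<open>\<beta>\<close>-transformation;
  the values outside \<open>I\<^sub>\<beta>\<close> are irrelevant.\<close>

definition greedy_map :: "real \<Rightarrow> real" where
  "greedy_map x = (if x < 1 / \<beta> then \<beta> * x else \<beta> * x - 1)"

text \<open>Meaningful for \<open>n \<ge> 1\<close>.\<close>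

definition greedy_digit :: "real \<Rightarrow> nat \<Rightarrow> nat" where
  "greedy_digit x n = (if (greedy_map ^^ (n - 1)) x < 1 / \<beta> then 0 else 1)"

definition greedy_acim :: "real measure \<Rightarrow> bool" where
  "greedy_acim \<mu> \<longleftrightarrow>
     sets \<mu> = sets borel_I\<^sub>\<beta> \<and> prob_space \<mu> \<and>
     absolutely_continuous (restrict_space lborel I\<^sub>\<beta>) \<mu> \<and>
     distr \<mu> borel_I\<^sub>\<beta> greedy_map = \<mu>"

text \<open>The description is proper: \<open>greedy_map\<close> has exactly one absolutely continuous invariant
  probability measure on \<open>I\<^sub>\<beta>\<close>, and it is concentrated on \<open>{0..1}\<close>.\<close>

definition greedy_invariant_measure :: "real measure" where
  "greedy_invariant_measure = (THE \<mu>. greedy_acim \<mu>)"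

text \<open>The digit frequency \<open>\<alpha>(1)\<close>.\<close>

definition \<alpha>\<^sub>1 :: real where
  "\<alpha>\<^sub>1 = measure greedy_invariant_measure {1 / \<beta> .. 1}"

end

theory Submission
  imports Defs
begin

text \<open>
  Almost every coin sequence is turned into a greedy expansion of the same number by the carries
  \<open>0(10)\<^sup>k11 = 10\<^bsup>2k+2\<^esup>\<close>. After a \<open>0\<close> these are carried out by a transducer that
  withholds a word \<open>0(10)\<^sup>k\<close> or \<open>0(10)\<^sup>k1\<close>, so that its states form a Markov chain. The word
  breaks up into independent blocks: \<open>0(10)\<^sup>k\<close> with probability \<open>4\<^bsup>-k\<^esup>/2\<close> and
  \<open>10\<^bsup>2k+1\<^esup>\<close> with probability \<open>4\<^bsup>-k\<^esup>/4\<close>, of mean length \<open>2\<close> and with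
  \<open>5/9\<close> ones on average, whence the frequency \<open>5/18\<close>. Instead of splitting into blocks, we
  count the ones by linear relations between additive functionals of the Markov chain, whose
  error terms are sums of martingale differences and hence \<open>o(n)\<close> almost surely.

  For \<open>\<alpha>\<^sub>1\<close>, put \<open>g\<^sub>n(t) = \<lambda>([0, t) \<inter> T\<^bsup>-n\<^esup>B) - \<mu>(B) t\<close> with the Parry
  measure \<open>\<mu>\<close>. Splitting \<open>[0, t)\<close> at \<open>1/\<beta>\<close> gives
  \<open>g\<^bsub>n+1\<^esub>(t) = g\<^sub>n(\<beta>t)/\<beta>\<close> or \<open>(g\<^sub>n(1) + g\<^sub>n(\<beta>t-1))/\<beta>\<close>, and
  \<open>g\<^bsub>n+1\<^esub>(1) = -g\<^sub>n(1)/\<beta>\<^sup>2\<close>, so \<open>g\<^sub>n \<rightarrow> 0\<close> uniformly.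
  Approximating an invariant density by step functions, every invariant absolutely continuous
  probability measure equals \<open>\<mu>\<close>.
\<close>

section \<open>The invariant measure of the greedy transformation\<close>

lemma beta_gt: "\<beta> > 8 / 5"
proof -
  \<comment> \<open>The resulting bound 8/5 is exactly what the final comparison needs: \<beta>^2 +
    1 = \<beta> + 2 exceeds 18/5 iff \<beta> > 8/5.\<close>
  have "sqrt 5 > 11 / 5" by (rule real_less_rsqrt) (simp add: power2_eq_square)
  then show ?thesis by (simp add: \<beta>_def)
qed

lemma beta_pos [simp]: "\<beta> > 0" "\<beta> \<noteq> 0" "\<beta> \<ge> 0" "\<not> \<beta> < 0" "\<not> \<beta> \<le> 0" "\<beta> > 1" "\<beta> \<ge> 1" "\<beta> - 1 > 0"
  using beta_gt by auto

lemma beta_lt: "\<beta> < 2"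
proof -
  have "sqrt 5 < 3" by (rule real_less_lsqrt) auto
  then show ?thesis by (simp add: \<beta>_def)
qed

lemma le_beta_mult: "0 \<le> x \<Longrightarrow> x \<le> \<beta> * x"
  using mult_right_mono[of 1 \<beta> x] by (simp add: less_imp_le)

lemma greedy_funpow_Suc: "(greedy_map ^^ Suc n) x = (greedy_map ^^ n) (greedy_map x)"
  by (simp add: funpow_swap1)

lemma less_inv_beta: "x < 1 / \<beta> \<longleftrightarrow> \<beta> * x < 1"
  by (simp add: field_simps)

lemma inv_beta_le_nonneg: "1 / \<beta> \<le> x \<Longrightarrow> 0 \<le> x"
  using order_trans[of 0 "1 / \<beta>" x] by simp

lemma beta_sq: "\<beta> * \<beta> = \<beta> + 1"
  by (simp add: \<beta>_def field_simps)

lemma inv_beta: "1 / \<beta> = \<beta> - 1"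
  using beta_sq by (simp add: field_simps)

lemma inv_beta_minus: "1 / (\<beta> - 1) = \<beta>"
  unfolding inv_beta[symmetric] by simp

lemma I_eq: "I\<^sub>\<beta> = {0..\<beta>}"
  by (simp add: I\<^sub>\<beta>_def inv_beta_minus)

lemma greedy_map_measurable [measurable]: "greedy_map \<in> borel_measurable borel"
  unfolding greedy_map_def[abs_def] by measurable

lemma greedy_funpow_measurable [measurable]: "(greedy_map ^^ n) \<in> borel_measurable borel"
  by (induction n) auto

lemma greedy_map_I: "x \<in> I\<^sub>\<beta> \<Longrightarrow> greedy_map x \<in> I\<^sub>\<beta>"
proof -
  assume "x \<in> I\<^sub>\<beta>"
  then have x: "0 \<le> x" "x \<le> \<beta>" by (auto simp: I_eq)
  have "\<beta> * x \<le> \<beta> * \<beta>" using x by (intro mult_left_mono) auto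
  moreover have "x < 1 / \<beta> \<Longrightarrow> \<beta> * x \<le> 1" "x \<ge> 1 / \<beta> \<Longrightarrow> \<beta> * x \<ge> 1" by (simp_all add: field_simps)
  ultimately show ?thesis using x beta_sq beta_gt le_beta_mult[of x] by (auto simp: greedy_map_def I_eq not_less)
qed

lemma measure_affine_vimage:
  fixes r s :: real
  assumes [measurable]: "A \<in> sets borel" and r: "r > 0"
  shows "measure lborel ((\<lambda>x. r * x + s) -` A) = measure lborel A / r"
proof -
  have "emeasure lborel A
      = emeasure (density (distr lborel borel (\<lambda>x. s + r * x)) (\<lambda>_. ennreal (abs r))) A"
    using lborel_real_affine[of r s] r by simp
  also have "\<dots> = ennreal r * emeasure lborel ((\<lambda>x. s + r * x) -` A)"
    using r by (simp add: emeasure_density nn_integral_cmult_indicator emeasure_distr)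
  finally show ?thesis
    using r by (simp add: measure_def enn2real_mult add.commute)
qed

section \<open>Lebesgue measure of preimages within initial intervals\<close>

definition visit :: "real set \<Rightarrow> nat \<Rightarrow> real \<Rightarrow> real" where
  "visit B n t = measure lborel ({0..<t} \<inter> (greedy_map ^^ n) -` B)"

lemma sets_vimage [measurable]: "B \<in> sets borel \<Longrightarrow> (greedy_map ^^ n) -` B \<in> sets borel"
  using measurable_sets[OF greedy_funpow_measurable[of n], of B] by simp

lemma measure_lborel_Un:
  assumes [measurable]: "A \<in> sets borel" "B \<in> sets borel"
    and "A \<inter> B = {}" "A \<subseteq> {a..b}" "B \<subseteq> {c..d}"
  shows "measure lborel (A \<union> B) = measure lborel A + measure lborel (B::real set)"
proof (rule measure_Un_AE)
  show "A \<in> fmeasurable lborel" "B \<in> fmeasurable lborel"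
    using assms(4,5) by (auto intro!: bounded_set_imp_lmeasurable bounded_subset[OF bounded_closed_interval] fmeasurableI2[OF fmeasurable_cbox])
qed (use assms in auto)

text \<open>Only the branch \<open>x \<mapsto> \<beta> * x\<close> is met, so the set is an affine
  preimage. Half-open intervals fit the branches: \<open>[0, 1/\<beta>)\<close> goes exactly onto
  \<open>[0, 1)\<close>.\<close>

lemma visit_step_low:
  assumes [measurable]: "B \<in> sets borel" and t: "0 \<le> t" "t \<le> 1 / \<beta>"
  shows "visit B (Suc n) t = visit B n (\<beta> * t) / \<beta>"
proof -
  have "{0..<t} \<inter> (greedy_map ^^ Suc n) -` B
      = (\<lambda>x. \<beta> * x + 0) -` ({0..<\<beta> * t} \<inter> (greedy_map ^^ n) -` B)"
    using t by (auto simp: greedy_funpow_Suc greedy_map_def zero_le_mult_iff simp del: funpow.simps)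
  then show ?thesis
    unfolding visit_def by (simp only:) (rule measure_affine_vimage, auto)
qed

text \<open>The first branch is swept completely, which is the low case at
  \<open>t = 1/\<beta>\<close>; the second carries \<open>[1/\<beta>, t)\<close> onto
  \<open>[0, \<beta> t - 1)\<close>.\<close>

lemma visit_step_high:
  assumes [measurable]: "B \<in> sets borel" and t: "1 / \<beta> \<le> t"
  shows "visit B (Suc n) t = (visit B n 1 + visit B n (\<beta> * t - 1)) / \<beta>"
proof -
  have split: "{0..<t} \<inter> (greedy_map ^^ Suc n) -` B
      = ({0..<1 / \<beta>} \<inter> (greedy_map ^^ Suc n) -` B)
        \<union> (\<lambda>x. \<beta> * x + (- 1)) -` ({0..<\<beta> * t - 1} \<inter> (greedy_map ^^ n) -` B)"
  proof (intro set_eqI iffI)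
    fix x assume "x \<in> {0..<t} \<inter> (greedy_map ^^ Suc n) -` B"
    then show "x \<in> ({0..<1 / \<beta>} \<inter> (greedy_map ^^ Suc n) -` B)
        \<union> (\<lambda>x. \<beta> * x + (- 1)) -` ({0..<\<beta> * t - 1} \<inter> (greedy_map ^^ n) -` B)"
      by (cases "x < 1 / \<beta>")
        (auto simp: greedy_funpow_Suc greedy_map_def less_inv_beta not_less simp del: funpow.simps)
  next
    fix x assume "x \<in> ({0..<1 / \<beta>} \<inter> (greedy_map ^^ Suc n) -` B)
        \<union> (\<lambda>x. \<beta> * x + (- 1)) -` ({0..<\<beta> * t - 1} \<inter> (greedy_map ^^ n) -` B)"
    moreover have "0 \<le> x" if "1 \<le> \<beta> * x" using that zero_le_mult_iff[of \<beta> x] by simp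
    ultimately show "x \<in> {0..<t} \<inter> (greedy_map ^^ Suc n) -` B"
      using t by (auto simp: greedy_funpow_Suc greedy_map_def not_less
          less_inv_beta[symmetric] simp del: funpow.simps) (auto simp: less_inv_beta)
  qed
  have "measure lborel ({0..<t} \<inter> (greedy_map ^^ Suc n) -` B)
      = measure lborel ({0..<1 / \<beta>} \<inter> (greedy_map ^^ Suc n) -` B)
        + measure lborel ((\<lambda>x. \<beta> * x + (- 1)) -` ({0..<\<beta> * t - 1} \<inter> (greedy_map ^^ n) -` B))"
    unfolding split
  proof (rule measure_lborel_Un)
    show "(\<lambda>x. \<beta> * x + - 1) -` ({0..<\<beta> * t - 1} \<inter> (greedy_map ^^ n) -` B) \<in> sets borel"
    proof -
      have "(\<lambda>x. \<beta> * x + - 1) -` ({0..<\<beta> * t - 1} \<inter> (greedy_map ^^ n) -` B) \<inter> space borel \<in> sets borel"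
        by (rule measurable_sets[where A=borel]) auto
      then show ?thesis by simp
    qed
    show "(\<lambda>x. \<beta> * x + - 1) -` ({0..<\<beta> * t - 1} \<inter> (greedy_map ^^ n) -` B) \<subseteq> {1/\<beta>..t}"
      by (auto simp: field_simps)
    show "{0..<1 / \<beta>} \<inter> (greedy_map ^^ Suc n) -` B \<subseteq> {0..1/\<beta>}" by auto
  qed (auto simp: field_simps simp del: funpow.simps)
  also have "measure lborel ((\<lambda>x. \<beta> * x + (- 1)) -` ({0..<\<beta> * t - 1} \<inter> (greedy_map ^^ n) -` B))
     = visit B n (\<beta> * t - 1) / \<beta>"
    unfolding visit_def by (subst measure_affine_vimage) auto
  finally show ?thesis
    using visit_step_low[OF assms(1), of "1 / \<beta>" n] by (simp add: visit_def add_divide_distrib del: funpow.simps)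
qed

text \<open>The value of the invariant density on \<open>[1/\<beta>, 1)\<close>; on \<open>[0, 1/\<beta>)\<close> the density is \<open>\<beta> c\<^sub>2\<close>.\<close>

definition c\<^sub>2 :: real where "c\<^sub>2 = \<beta>\<^sup>2 / (\<beta>\<^sup>2 + 1)"

text \<open>The mass of \<open>B\<close> under the Parry measure. Its density, equal to \<beta>
  times the base value on \<open>[0, 1/\<beta>)\<close>, is written as a combination of indicators
  of initial intervals, so that the recursion for \<open>visit\<close> applies.\<close>

definition parry_mass :: "real set \<Rightarrow> real" where
  "parry_mass B = c\<^sub>2 * (visit B 0 1 + (\<beta> - 1) * visit B 0 (1 / \<beta>))"

text \<open>The recursion sends the pair of values at 1 and 1/\<beta> to
  \<open>((v + w)/\<beta>, v/\<beta>)\<close>, and the weights \<open>(1, \<beta> - 1)\<close> form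
  a left fixed vector of this map because 1/\<beta> = \<beta> - 1.\<close>

lemma parry_mass_invariant:
  assumes [measurable]: "B \<in> sets borel"
  shows "c\<^sub>2 * (visit B n 1 + (\<beta> - 1) * visit B n (1 / \<beta>)) = parry_mass B"
proof (induction n)
  case (Suc n)
  have "visit B (Suc n) 1 = (visit B n 1 + visit B n (1 / \<beta>)) / \<beta>"
    using visit_step_high[OF assms, of 1 n] beta_lt by (simp add: inv_beta)
  moreover have "visit B (Suc n) (1 / \<beta>) = visit B n 1 / \<beta>"
    using visit_step_low[OF assms, of "1/\<beta>" n] by simp
  ultimately have "visit B (Suc n) 1 + (\<beta> - 1) * visit B (Suc n) (1 / \<beta>)
     = visit B n 1 * ((1 + (\<beta> - 1)) / \<beta>) + visit B n (1 / \<beta>) * (1/\<beta>)"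
    by (simp add: field_simps)
  then show ?case using Suc by (simp add: inv_beta mult.commute)
qed (simp add: parry_mass_def)

lemma visit_bounds:
  assumes "B \<in> sets borel" "0 \<le> t" shows "0 \<le> visit B n t" "visit B n t \<le> t"
proof -
  show "0 \<le> visit B n t" by (simp add: visit_def)
  have "visit B n t \<le> measure lborel {0..<t}"
    unfolding visit_def by (rule measure_mono_fmeasurable) (use assms in \<open>auto simp: fmeasurable_def\<close>)
  then show "visit B n t \<le> t" using assms by simp
qed

lemma c2_pos: "c\<^sub>2 > 0" and c2_eq: "c\<^sub>2 * (1 + (\<beta> - 1) / \<beta>) = 1"
proof -
  have *: "\<beta>\<^sup>2 + 1 > 0" by (simp add: add_nonneg_pos)
  then show "c\<^sub>2 > 0" by (simp add: c\<^sub>2_def)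
  have "\<beta>\<^sup>2 * (1 + (\<beta> - 1) / \<beta>) = \<beta>\<^sup>2 + 1" using beta_sq by (simp add: power2_eq_square field_simps)
  then show "c\<^sub>2 * (1 + (\<beta> - 1) / \<beta>) = 1" using * unfolding c\<^sub>2_def times_divide_eq_left by simp
qed

lemma parry_mass_bounds:
  assumes [measurable]: "B \<in> sets borel"
  shows "0 \<le> parry_mass B" "parry_mass B \<le> 1"
proof -
  note b = visit_bounds[OF assms, of 1 0] visit_bounds[OF assms, of "1/\<beta>" 0]
  show "0 \<le> parry_mass B" unfolding parry_mass_def using b c2_pos
    by (intro mult_nonneg_nonneg add_nonneg_nonneg) auto
  have "(\<beta> - 1) * visit B 0 (1 / \<beta>) \<le> (\<beta> - 1) * (1 / \<beta>)" using b by (intro mult_left_mono) auto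
  then have "parry_mass B \<le> c\<^sub>2 * (1 + (\<beta> - 1) / \<beta>)"
    unfolding parry_mass_def using b c2_pos by (intro mult_left_mono) auto
  then show "parry_mass B \<le> 1" by (simp add: c2_eq)
qed

text \<open>This is the function g_n of the overview.\<close>

definition defect :: "real set \<Rightarrow> nat \<Rightarrow> real \<Rightarrow> real" where
  "defect B n t = visit B n t - parry_mass B * t"

text \<open>Invariance of the weighted sum ties the defects at 1 and 1/\<beta> together, so the
  recursion at 1 closes on itself with the factor -1/\<beta>^2; the cruder 1/\<beta> suffices
  here.\<close>

lemma defect_one:
  assumes [measurable]: "B \<in> sets borel"
  shows "\<bar>defect B n 1\<bar> \<le> 1 / \<beta> ^ n"
proof (induction n)
  case 0
  show ?case using visit_bounds[OF assms, of 1 0] parry_mass_bounds[OF assms] by (simp add: defect_def abs_le_iff)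
next
  case (Suc n)
  have "c\<^sub>2 * (visit B n 1 + (\<beta> - 1) * visit B n (1 / \<beta>)) = parry_mass B * (c\<^sub>2 * (1 + (\<beta> - 1) / \<beta>))"
    using parry_mass_invariant[OF assms] by (simp add: c2_eq)
  then have "c\<^sub>2 * (defect B n 1 + (\<beta> - 1) * defect B n (1 / \<beta>)) = 0"
    by (simp add: defect_def algebra_simps)
  then have "defect B n 1 + (\<beta> - 1) * defect B n (1 / \<beta>) = 0" using c2_pos by simp
  then have z: "defect B n 1 = - (\<beta> - 1) * defect B n (1 / \<beta>)" by algebra
  \<comment> \<open>Multiplying by \<beta> makes the coefficient \<beta>^2 - \<beta> = 1
    appear.\<close>
  have "\<beta> * defect B n 1 = - (\<beta> * \<beta> - \<beta>) * defect B n (1 / \<beta>)" unfolding z by algebra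
  then have z: "defect B n (1 / \<beta>) = - \<beta> * defect B n 1" using beta_sq by simp
  have "visit B (Suc n) 1 = (visit B n 1 + visit B n (1 / \<beta>)) / \<beta>"
    using visit_step_high[OF assms, of 1 n] beta_lt by (simp add: inv_beta)
  then have "defect B (Suc n) 1 = (defect B n 1 + defect B n (1 / \<beta>)) / \<beta>
      + parry_mass B * ((1 + 1 / \<beta>) / \<beta> - 1)"
    by (simp add: defect_def field_simps)
  also have "(1 + 1 / \<beta>) / \<beta> - 1 = 0" by (simp add: inv_beta)
  finally have "defect B (Suc n) 1 = (1 - \<beta>) * defect B n 1 / \<beta>" by (simp add: z algebra_simps)
  then have "\<bar>defect B (Suc n) 1\<bar> = ((\<beta> - 1) * \<bar>defect B n 1\<bar>) / \<beta>" by (simp add: abs_mult)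
  also have "\<dots> \<le> (1 * \<bar>defect B n 1\<bar>) / \<beta>"
    using beta_lt by (intro divide_right_mono mult_right_mono) auto
  also have "\<dots> \<le> (1 / \<beta> ^ n) / \<beta>" using Suc by (intro divide_right_mono) auto
  finally show ?case by (simp add: field_simps)
qed

text \<open>Each step divides by \<beta> and adds at most one defect at 1, of size at most
  \<beta>^(-n); this accounts for the linear numerator. The range \<open>[0, \<beta>]\<close> is
  kept since \<beta>^2 - 1 = \<beta>.\<close>

lemma defect_bound:
  assumes [measurable]: "B \<in> sets borel"
  shows "0 \<le> t \<Longrightarrow> t \<le> \<beta> \<Longrightarrow> \<bar>defect B n t\<bar> \<le> (real n + \<beta>) / \<beta> ^ n"
proof (induction n arbitrary: t)
  case 0
  have "parry_mass B * t \<le> t" "0 \<le> parry_mass B * t" using parry_mass_bounds[OF assms] 0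
    by (auto intro: mult_left_le_one_le)
  then show ?case using visit_bounds[OF assms 0(1), of 0] 0 by (auto simp: defect_def abs_le_iff)
next
  case (Suc n)
  show ?case
  proof (cases "t \<le> 1 / \<beta>")
    case True
    then have "\<beta> * t \<le> 1" by (simp add: field_simps)
    then have "\<bar>defect B n (\<beta> * t)\<bar> \<le> (real n + \<beta>) / \<beta> ^ n" using Suc.prems
      by (intro Suc.IH) (use le_beta_mult[of t] in auto)
    moreover have "defect B (Suc n) t = defect B n (\<beta> * t) / \<beta>"
      using visit_step_low[OF assms Suc.prems(1) True] by (simp add: defect_def field_simps)
    ultimately have "\<bar>defect B (Suc n) t\<bar> \<le> ((real n + \<beta>) / \<beta> ^ n) / \<beta>"
      using divide_right_mono[of "\<bar>defect B n (\<beta> * t)\<bar>" "(real n + \<beta>) / \<beta> ^ n" \<beta>]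
      by simp
    also have "\<dots> \<le> (real (Suc n) + \<beta>) / \<beta> ^ Suc n" by (simp add: field_simps)
    finally show ?thesis .
  next
    case False
    then have "0 \<le> \<beta> * t - 1" by (simp add: field_simps)
    moreover have "\<beta> * t \<le> \<beta> * \<beta>" using Suc.prems by (intro mult_left_mono) auto
    ultimately have "\<bar>defect B n (\<beta> * t - 1)\<bar> \<le> (real n + \<beta>) / \<beta> ^ n" using beta_sq
      by (intro Suc.IH) auto
    moreover have "defect B (Suc n) t = (defect B n 1 + defect B n (\<beta> * t - 1)) / \<beta>"
      using visit_step_high[OF assms, of t n] False by (simp add: defect_def field_simps)
    ultimately have "\<bar>defect B (Suc n) t\<bar> \<le> (1 / \<beta> ^ n + (real n + \<beta>) / \<beta> ^ n) / \<beta>"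
      using defect_one[OF assms, of n] by (simp add: divide_right_mono)
    also have "\<dots> = (real (Suc n) + \<beta>) / \<beta> ^ Suc n" by (simp add: field_simps)
    finally show ?thesis .
  qed
qed

lemma visit_tendsto:
  assumes [measurable]: "B \<in> sets borel" and t: "0 \<le> t" "t \<le> \<beta>"
  shows "(\<lambda>n. visit B n t) \<longlonglongrightarrow> parry_mass B * t"
proof -
  have 1: "(\<lambda>n. real n * (1 / \<beta>) ^ n) \<longlonglongrightarrow> 0"
    by (rule powser_times_n_limit_0) simp
  have 2: "(\<lambda>n. (1 / \<beta>) ^ n) \<longlonglongrightarrow> 0"
    by (rule LIMSEQ_power_zero) simp
  have "(\<lambda>n. (real n + \<beta>) / \<beta> ^ n) \<longlonglongrightarrow> 0"
    using tendsto_add[OF 1 tendsto_mult_left[OF 2, of \<beta>]]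
    by (simp add: add_divide_distrib power_divide)
  then have "(\<lambda>n. defect B n t) \<longlonglongrightarrow> 0"
    by (rule Lim_null_comparison[rotated]) (auto intro!: always_eventually defect_bound t)
  then show ?thesis by (simp add: defect_def LIM_zero_iff)
qed


section \<open>From intervals to Borel sets and densities; uniqueness\<close>

lemma space_I [simp]: "space (restrict_space lborel I\<^sub>\<beta>) = I\<^sub>\<beta>" "space borel_I\<^sub>\<beta> = I\<^sub>\<beta>"
  by (simp_all add: space_restrict_space)

lemma sets_I: "A \<in> sets borel_I\<^sub>\<beta> \<longleftrightarrow> A \<in> sets borel \<and> A \<subseteq> I\<^sub>\<beta>"
proof -
  have "I\<^sub>\<beta> \<inter> space borel \<in> sets (borel :: real measure)" by (simp add: I\<^sub>\<beta>_def)
  from sets_restrict_space_iff[OF this] show ?thesis by blast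
qed

lemma sets_lborel_I: "sets (restrict_space lborel I\<^sub>\<beta>) = sets borel_I\<^sub>\<beta>"
  by (rule sets_restrict_space_cong) simp

lemma finite_lborel_I: "finite_measure (restrict_space lborel I\<^sub>\<beta>)"
  by (rule finite_measureI) (simp add: emeasure_restrict_space I_eq)

lemma greedy_measurable_I: "greedy_map \<in> borel_I\<^sub>\<beta> \<rightarrow>\<^sub>M borel_I\<^sub>\<beta>"
  by (intro measurable_restrict_space2 measurable_restrict_space1) (auto intro: greedy_map_I)

lemma sigma_sets_lessThan: "sigma_sets UNIV (range lessThan) = sets (borel :: real measure)"
  unfolding borel_Iio by simp

definition visit_set :: "real set \<Rightarrow> nat \<Rightarrow> real set \<Rightarrow> real" where
  "visit_set B n A = measure lborel (A \<inter> I\<^sub>\<beta> \<inter> (greedy_map ^^ n) -` B)"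

lemma fmeasurable_I: "A \<in> sets borel \<Longrightarrow> A \<inter> I\<^sub>\<beta> \<in> fmeasurable lborel"
  by (rule fmeasurableI2[of "{0..\<beta>}"]) (auto simp: I_eq fmeasurable_def)

lemma visit_set_le:
  assumes "A \<in> sets borel" "B \<in> sets borel"
  shows "visit_set B n A \<le> measure lborel (A \<inter> I\<^sub>\<beta>)"
  unfolding visit_set_def using assms by (intro measure_mono_fmeasurable fmeasurable_I) (auto simp: I_eq)

lemma visit_set_nonneg: "0 \<le> visit_set B n A"
  by (simp add: visit_set_def)

text \<open>A Dynkin-system argument from the half-lines, where the limit is known. Complements are
  taken against the whole interval, and disjoint unions use dominated convergence of series.\<close>

lemma visit_set_tendsto:
  assumes B [measurable]: "B \<in> sets borel" and "A \<in> sets borel"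
  shows "(\<lambda>n. visit_set B n A) \<longlonglongrightarrow> parry_mass B * measure lborel (A \<inter> I\<^sub>\<beta>)"
proof -
  have fm: "X \<inter> I\<^sub>\<beta> \<inter> (greedy_map ^^ n) -` B \<in> fmeasurable lborel" if "X \<in> sets borel" for X n
    using fmeasurable_I[of "X \<inter> (greedy_map ^^ n) -` B"] that by (simp add: Int_ac)
  have whole: "(\<lambda>n. visit_set B n UNIV) \<longlonglongrightarrow> parry_mass B * \<beta>"
  proof -
    have "visit_set B n UNIV = visit B n \<beta>" for n
      unfolding visit_set_def visit_def
      by (rule measure_eq_AE) (use AE_lborel_singleton[of \<beta>] in \<open>auto simp: I_eq\<close>)
    then show ?thesis using visit_tendsto[OF B, of \<beta>] by simp
  qed
  have 1: "Int_stable (range (lessThan :: real \<Rightarrow> real set))"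
  proof (clarsimp simp: Int_stable_def)
    fix a b :: real
    have "{..<a} \<inter> {..<b} = {..<min a b}" by auto
    then show "{..<a} \<inter> {..<b} \<in> range lessThan" by blast
  qed
  have 2: "range (lessThan :: real \<Rightarrow> real set) \<subseteq> Pow UNIV" by simp
  have 3: "A \<in> sigma_sets UNIV (range lessThan)"
    using assms(2) unfolding sigma_sets_lessThan by simp
  from 1 2 3 show ?thesis
  proof (induction rule: sigma_sets_induct_disjoint)
    case (basic A)
    then obtain t where A: "A = {..<t}" by auto
    \<comment> \<open>Clamping \<open>t\<close> to \<open>[0, \<beta>]\<close> leaves the traces on
      the interval equal up to the single point \<beta>, a null set.\<close>
    define t' where "t' = min \<beta> (max 0 t)"
    have t': "0 \<le> t'" "t' \<le> \<beta>" by (auto simp: t'_def)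
    have "visit_set B n A = visit B n t'" for n
      unfolding visit_set_def visit_def A
      by (rule measure_eq_AE) (use AE_lborel_singleton[of \<beta>] in \<open>auto simp: I_eq t'_def\<close>)
    moreover have "measure lborel (A \<inter> I\<^sub>\<beta>) = measure lborel {0..<t'}"
      unfolding A
      by (rule measure_eq_AE) (use AE_lborel_singleton[of \<beta>] in \<open>auto simp: I_eq t'_def\<close>)
    ultimately show ?case using visit_tendsto[OF B t'] t' by simp
  next
    case empty
    then show ?case by (simp add: visit_set_def)
  next
    case (compl A)
    then have A [measurable]: "A \<in> sets borel" unfolding sigma_sets_lessThan by simp
    have "visit_set B n (UNIV - A) = visit_set B n UNIV - visit_set B n A" for n
    proof -
      have "(UNIV - A) \<inter> I\<^sub>\<beta> \<inter> (greedy_map ^^ n) -` B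
          = (UNIV \<inter> I\<^sub>\<beta> \<inter> (greedy_map ^^ n) -` B) - (A \<inter> I\<^sub>\<beta> \<inter> (greedy_map ^^ n) -` B)" by auto
      then show ?thesis unfolding visit_set_def using fm[OF A, of n] fm[of UNIV n]
        by (simp only:) (subst measurable_measure_Diff, auto)
    qed
    moreover have "measure lborel ((UNIV - A) \<inter> I\<^sub>\<beta>) = \<beta> - measure lborel (A \<inter> I\<^sub>\<beta>)"
    proof -
      have "(UNIV - A) \<inter> I\<^sub>\<beta> = (UNIV \<inter> I\<^sub>\<beta>) - (A \<inter> I\<^sub>\<beta>)" by auto
      then show ?thesis using fmeasurable_I[OF A] fmeasurable_I[of UNIV]
        by (simp only:) (subst measurable_measure_Diff, auto simp: I_eq)
    qed
    ultimately show ?case using tendsto_diff[OF whole compl.IH] by (simp only: right_diff_distrib)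
  next
    case (union A)
    then have A [measurable]: "A i \<in> sets borel" for i unfolding sigma_sets_lessThan by auto
    \<comment> \<open>The statement is for all \<open>B\<close> because \<open>UNIV\<close> at time
      0 also yields the plain measures, which serve as the summable majorant.\<close>
    have sums: "(\<lambda>i. measure lborel (A i \<inter> I\<^sub>\<beta> \<inter> (greedy_map ^^ n) -` B)) sums visit_set B n (\<Union>i. A i)"
      if "B \<in> sets borel" for n B
    proof -
      have [measurable]: "(greedy_map ^^ n) -` B \<in> sets borel" using that by simp
      have "(\<Union>i. A i) \<inter> I\<^sub>\<beta> \<inter> (greedy_map ^^ n) -` B = (\<Union>i. A i \<inter> I\<^sub>\<beta> \<inter> (greedy_map ^^ n) -` B)" by auto
      moreover have "emeasure lborel ((\<Union>i. A i) \<inter> I\<^sub>\<beta> \<inter> (greedy_map ^^ n) -` B) \<noteq> \<infinity>"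
        using fmeasurable_I[of "(\<Union>i. A i) \<inter> (greedy_map ^^ n) -` B"] by (simp add: Int_ac fmeasurable_def less_top)
      ultimately show ?thesis unfolding visit_set_def using union
        by (simp only:) (intro measure_UNION, auto simp: disjoint_family_on_def I_eq)
    qed
    have s: "(\<lambda>i. measure lborel (A i \<inter> I\<^sub>\<beta>)) sums measure lborel ((\<Union>i. A i) \<inter> I\<^sub>\<beta>)"
      using sums[of UNIV 0] by (simp add: visit_set_def)
    have "(\<lambda>n. \<Sum>i. visit_set B n (A i)) \<longlonglongrightarrow> (\<Sum>i. parry_mass B * measure lborel (A i \<inter> I\<^sub>\<beta>))"
    proof (rule tannerys_theorem[THEN conjunct2, THEN conjunct2])
      show "(\<lambda>n. visit_set B n (A i)) \<longlonglongrightarrow> parry_mass B * measure lborel (A i \<inter> I\<^sub>\<beta>)" for i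
        by (rule union.IH)
      show "\<forall>\<^sub>F (i, n) in sequentially \<times>\<^sub>F sequentially. norm (visit_set B n (A i)) \<le> measure lborel (A i \<inter> I\<^sub>\<beta>)"
        using visit_set_le[OF A B] by (intro always_eventually) (simp add: visit_set_nonneg split_beta)
      show "summable (\<lambda>i. measure lborel (A i \<inter> I\<^sub>\<beta>))" by (rule sums_summable[OF s])
    qed simp
    moreover have "(\<Sum>i. visit_set B n (A i)) = visit_set B n (\<Union>i. A i)" for n
      using sums_unique[OF sums[OF B, of n]] by (simp add: visit_set_def)
    moreover have "(\<Sum>i. parry_mass B * measure lborel (A i \<inter> I\<^sub>\<beta>))
        = parry_mass B * measure lborel ((\<Union>i. A i) \<inter> I\<^sub>\<beta>)"
      using sums_unique[OF sums_mult[OF s]] by simp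
    ultimately show ?case by simp
  qed
qed

text \<open>Indicators are the previous lemma; sums are linear; limits follow by L1 approximation,
  the error being uniform in \<open>n\<close>.\<close>

lemma integral_visit_tendsto:
  fixes f :: "real \<Rightarrow> real"
  defines "L \<equiv> restrict_space lborel I\<^sub>\<beta>"
  assumes B [measurable]: "B \<in> sets borel" and "integrable L f"
  shows "(\<lambda>n. \<integral>x. f x * indicator ((greedy_map ^^ n) -` B) x \<partial>L) \<longlonglongrightarrow> parry_mass B * (\<integral>x. f x \<partial>L)"
  using assms(3)
proof (induction rule: integrable_induct)
  have ind [measurable]: "(\<lambda>x. indicator ((greedy_map ^^ n) -` B) x :: real) \<in> borel_measurable L" for n
    unfolding L_def by (intro measurable_restrict_space1) auto
  have int: "integrable L (\<lambda>x. f x * indicator ((greedy_map ^^ n) -` B) x)" if "integrable L f" for f :: "real \<Rightarrow> real" and n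
  proof (rule Bochner_Integration.integrable_bound[OF that])
    show "(\<lambda>x. f x * indicator ((greedy_map ^^ n) -` B) x) \<in> borel_measurable L"
      using that by (intro borel_measurable_times ind) auto
  qed (auto simp: indicator_def intro!: always_eventually)
  {
    case (base A c)
    then have A: "A \<in> sets borel" "A \<subseteq> I\<^sub>\<beta>" by (auto simp: L_def sets_lborel_I sets_I)
    have *: "measure L (A \<inter> X \<inter> space L) = measure lborel (A \<inter> I\<^sub>\<beta> \<inter> X)" if "X \<in> sets borel" for X
    proof -
      have "A \<inter> X \<inter> I\<^sub>\<beta> = A \<inter> I\<^sub>\<beta> \<inter> X" by auto
      then show ?thesis using A that unfolding L_def
        by simp (subst measure_restrict_space, auto simp: I_eq)
    qed
    have "(\<integral>x. (indicator A x *\<^sub>R c) * indicator ((greedy_map ^^ n) -` B) x \<partial>L)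
        = (\<integral>x. c * indicator (A \<inter> (greedy_map ^^ n) -` B) x \<partial>L)" for n
      by (intro Bochner_Integration.integral_cong) (auto simp: indicator_def)
    moreover have "(\<integral>x. c * indicator (A \<inter> (greedy_map ^^ n) -` B) x \<partial>L) = c * visit_set B n A" for n
      unfolding integral_mult_right_zero Bochner_Integration.integral_indicator visit_set_def
      by (rule arg_cong[where f="\<lambda>x. c * x"]) (rule *[OF sets_vimage[OF B, of n]])
    ultimately have e1: "(\<integral>x. (indicator A x *\<^sub>R c) * indicator ((greedy_map ^^ n) -` B) x \<partial>L) = c * visit_set B n A" for n
      by (rule trans)
    have e2: "(\<integral>x. indicator A x *\<^sub>R c \<partial>L) = c * measure lborel (A \<inter> I\<^sub>\<beta>)"
      using *[of UNIV] by (simp add: mult.commute)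
    show ?case unfolding e1 e2 mult.left_commute[of "parry_mass B"]
      by (rule tendsto_mult_left[OF visit_set_tendsto[OF B A(1)]])
  next
    case (add f g)
    then show ?case using tendsto_add[OF add.IH] int[OF add.hyps(1)] int[OF add.hyps(2)]
      by (simp add: distrib_left distrib_right)
  next
    case (lim f s)
    have conv: "(\<lambda>i. \<integral>x. \<bar>f x - s i x\<bar> \<partial>L) \<longlonglongrightarrow> (\<integral>x. 0 \<partial>L)"
    proof (rule integral_dominated_convergence)
      \<comment> \<open>The approximants satisfy
        \<open>\<bar>s i x\<bar> \<le> 2 * \<bar>f x\<bar>\<close>, hence the factor 3.\<close>
      show "integrable L (\<lambda>x. 3 * \<bar>f x\<bar>)" using lim.hyps by simp
      show "AE x in L. (\<lambda>i. \<bar>f x - s i x\<bar>) \<longlonglongrightarrow> 0"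
        by (rule AE_I2, rule tendsto_eq_intros) (auto intro!: tendsto_eq_intros lim.hyps)
      show "AE x in L. norm \<bar>f x - s i x\<bar> \<le> 3 * \<bar>f x\<bar>" for i
      proof (rule AE_I2)
        fix x assume "x \<in> space L"
        from lim.hyps(3)[OF this, of i] show "norm \<bar>f x - s i x\<bar> \<le> 3 * \<bar>f x\<bar>" by simp
      qed
    qed (use lim.hyps in \<open>auto intro!: borel_measurable_integrable\<close>)
    show ?case
    proof (rule LIMSEQ_I)
      fix e :: real assume "e > 0"
      let ?F = "\<lambda>g n. \<integral>x. g x * indicator ((greedy_map ^^ n) -` B) x \<partial>L"
      obtain i where i: "(\<integral>x. \<bar>f x - s i x\<bar> \<partial>L) < e / 3"
        using order_tendstoD(2)[OF conv, of "e/3"] \<open>e > 0\<close> by (auto simp: eventually_sequentially)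
      have df: "integrable L (\<lambda>x. f x - s i x)" using lim.hyps by auto
      have close: "\<bar>?F f n - ?F (s i) n\<bar> < e / 3" for n
      proof -
        have "?F f n - ?F (s i) n = (\<integral>x. (f x - s i x) * indicator ((greedy_map ^^ n) -` B) x \<partial>L)"
          using int[OF lim.hyps(4), of n] int[OF lim.hyps(1), of i n] by (simp add: left_diff_distrib)
        also have "\<bar>\<dots>\<bar> \<le> (\<integral>x. \<bar>(f x - s i x) * indicator ((greedy_map ^^ n) -` B) x\<bar> \<partial>L)"
          by (rule integral_abs_bound)
        also have "\<dots> \<le> (\<integral>x. \<bar>f x - s i x\<bar> \<partial>L)"
          by (rule integral_mono) (use df int[OF df] in \<open>auto simp: indicator_def\<close>)
        finally show ?thesis using i by simp
      qed
      have close': "\<bar>parry_mass B * (\<integral>x. f x \<partial>L) - parry_mass B * (\<integral>x. s i x \<partial>L)\<bar> < e / 3"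
      proof -
        have "parry_mass B * (\<integral>x. f x \<partial>L) - parry_mass B * (\<integral>x. s i x \<partial>L) = parry_mass B * (\<integral>x. f x - s i x \<partial>L)"
          using lim.hyps by (simp add: right_diff_distrib)
        also have "\<bar>\<dots>\<bar> \<le> 1 * (\<integral>x. \<bar>f x - s i x\<bar> \<partial>L)"
          unfolding abs_mult using parry_mass_bounds[OF B] by (intro mult_mono integral_abs_bound) auto
        finally show ?thesis using i by simp
      qed
      from LIMSEQ_D[OF lim.IH[of i], of "e/3"] \<open>e > 0\<close> obtain N where
        N: "\<And>n. n \<ge> N \<Longrightarrow> norm (?F (s i) n - parry_mass B * (\<integral>x. s i x \<partial>L)) < e / 3" by auto
      show "\<exists>N. \<forall>n\<ge>N. norm (?F f n - parry_mass B * (\<integral>x. f x \<partial>L)) < e"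
      proof (intro exI[of _ N] allI impI)
        fix n assume "n \<ge> N"
        then show "norm (?F f n - parry_mass B * (\<integral>x. f x \<partial>L)) < e"
          using N[of n] close[of n] close' unfolding real_norm_def by linarith
      qed
    qed
  }
qed

text \<open>By invariance the integral of the density over the n-th preimage of \<open>B\<close> is
  the constant \<mu>(B), while it converges to \<open>parry_mass B\<close> times the total mass
  1.\<close>

lemma acim_eq_parry_mass:
  assumes "greedy_acim \<mu>" and B: "B \<in> sets borel_I\<^sub>\<beta>"
  shows "emeasure \<mu> B = ennreal (parry_mass B)"
proof -
  let ?L = "restrict_space lborel I\<^sub>\<beta>"
  from assms have sets: "sets \<mu> = sets borel_I\<^sub>\<beta>" and "prob_space \<mu>"
    and ac: "absolutely_continuous ?L \<mu>" and inv: "distr \<mu> borel_I\<^sub>\<beta> greedy_map = \<mu>"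
    by (auto simp: greedy_acim_def)
  interpret prob_space \<mu> by fact
  interpret L: finite_measure ?L by (rule finite_lborel_I)
  obtain F where F [measurable]: "F \<in> borel_measurable ?L" and dens: "density ?L F = \<mu>"
    using L.Radon_Nikodym[OF ac] sets sets_lborel_I by auto
  have sp: "space \<mu> = I\<^sub>\<beta>" using sets_eq_imp_space_eq[OF sets] by simp
  have B': "B \<in> sets borel" "B \<subseteq> I\<^sub>\<beta>" using B by (auto simp: sets_I)
  have pre: "I\<^sub>\<beta> \<inter> (greedy_map ^^ n) -` B \<in> sets borel_I\<^sub>\<beta>" for n
    using sets_vimage[OF B'(1), of n] unfolding sets_I by (auto simp: I_eq)
  have inv_n: "emeasure \<mu> (I\<^sub>\<beta> \<inter> (greedy_map ^^ n) -` B) = emeasure \<mu> B" for n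
  proof (induction n)
    case (Suc n)
    have "emeasure \<mu> (I\<^sub>\<beta> \<inter> (greedy_map ^^ n) -` B)
        = emeasure \<mu> (greedy_map -` (I\<^sub>\<beta> \<inter> (greedy_map ^^ n) -` B) \<inter> space \<mu>)"
      by (subst inv[symmetric], subst emeasure_distr)
        (use greedy_measurable_I pre in \<open>auto simp: measurable_cong_sets[OF sets refl]\<close>)
    also have "greedy_map -` (I\<^sub>\<beta> \<inter> (greedy_map ^^ n) -` B) \<inter> space \<mu> = I\<^sub>\<beta> \<inter> (greedy_map ^^ Suc n) -` B"
      using greedy_map_I by (auto simp: sp greedy_funpow_Suc simp del: funpow.simps)
    finally show ?case using Suc by (simp del: funpow.simps)
  qed (use B' in \<open>simp add: Int_absorb1\<close>)
  have F_int: "(\<integral>\<^sup>+x. F x \<partial>?L) = 1"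
  proof -
    have "1 = (\<integral>\<^sup>+x. F x * indicator (space ?L) x \<partial>?L)"
      using emeasure_space_1 unfolding dens[symmetric] space_density
      by (subst (asm) emeasure_density) (auto simp del: space_I)
    also have "\<dots> = (\<integral>\<^sup>+x. F x \<partial>?L)" by (intro nn_integral_cong) auto
    finally show ?thesis by simp
  qed
  \<comment> \<open>The Radon-Nikodym density takes extended values; having integral 1 it is finite
    almost everywhere, so a real version exists.\<close>
  define f where "f x = enn2real (F x)" for x
  have f0: "0 \<le> f x" for x by (simp add: f_def)
  have [measurable]: "f \<in> borel_measurable ?L" unfolding f_def by measurable
  have "AE x in ?L. F x \<noteq> \<infinity>" by (rule nn_integral_PInf_AE) (use F_int in auto)
  then have Ff: "AE x in ?L. F x = ennreal (f x)" by (auto simp: f_def less_top)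
  have "(\<integral>\<^sup>+x. ennreal (f x) \<partial>?L) = 1"
    using nn_integral_cong_AE[OF Ff] F_int by simp
  then have f: "integrable ?L f" "(\<integral>x. f x \<partial>?L) = 1"
    by (auto intro!: integrableI_nonneg integral_eq_nn_integral[THEN trans] simp: f0)
  have "(\<integral>x. f x * indicator ((greedy_map ^^ n) -` B) x \<partial>?L) = measure \<mu> B" for n
  proof -
    have "(\<lambda>x. indicator ((greedy_map ^^ n) -` B) x :: real) \<in> borel_measurable ?L"
      using B' by (intro measurable_restrict_space1) auto
    then have meas: "(\<lambda>x. f x * indicator ((greedy_map ^^ n) -` B) x) \<in> borel_measurable ?L" by measurable
    have "emeasure \<mu> B = (\<integral>\<^sup>+x. F x * indicator (I\<^sub>\<beta> \<inter> (greedy_map ^^ n) -` B) x \<partial>?L)"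
      unfolding inv_n[of n, symmetric] unfolding dens[symmetric]
      using pre by (subst emeasure_density) (auto simp: sets_lborel_I)
    also have "\<dots> = (\<integral>\<^sup>+x. ennreal (f x * indicator ((greedy_map ^^ n) -` B) x) \<partial>?L)"
      by (rule nn_integral_cong_AE) (use Ff AE_space in eventually_elim, auto simp: indicator_def)
    finally have e: "emeasure \<mu> B = \<dots>" .
    show ?thesis unfolding measure_def e
      by (rule integral_eq_nn_integral[OF meas]) (intro AE_I2 mult_nonneg_nonneg f0 indicator_pos_le)
  qed
  with integral_visit_tendsto[OF B'(1) f(1)] f(2) have "(\<lambda>n. measure \<mu> B) \<longlonglongrightarrow> parry_mass B" by simp
  then have "measure \<mu> B = parry_mass B" by (simp add: LIMSEQ_const_iff)
  then show ?thesis by (simp add: emeasure_eq_measure)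
qed

section \<open>The Parry measure and the value of \<open>\<alpha>\<^sub>1\<close>\<close>

definition parry_density :: "real \<Rightarrow> real" where
  "parry_density x = c\<^sub>2 * (indicator {0..<1} x + (\<beta> - 1) * indicator {0..<1 / \<beta>} x)"

definition parry_measure :: "real measure" where
  "parry_measure = density (restrict_space lborel I\<^sub>\<beta>) (\<lambda>x. ennreal (parry_density x))"

lemma sets_parry_measure: "sets parry_measure = sets borel_I\<^sub>\<beta>"
  by (simp add: parry_measure_def sets_lborel_I)

lemma emeasure_parry_measure:
  assumes "B \<in> sets borel_I\<^sub>\<beta>"
  shows "emeasure parry_measure B = ennreal (parry_mass B)"
proof -
  let ?L = "restrict_space lborel I\<^sub>\<beta>"
  have B: "B \<in> sets borel" "B \<subseteq> I\<^sub>\<beta>" using assms by (auto simp: sets_I)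
  have [measurable]: "parry_density \<in> borel_measurable ?L"
    unfolding parry_density_def[abs_def] by (intro measurable_restrict_space1) auto
  have em: "emeasure ?L (X \<inter> B) = ennreal (measure lborel (X \<inter> B))" "X \<inter> B \<in> sets ?L" if "X \<in> sets borel" for X
  proof -
    show "X \<inter> B \<in> sets ?L" using B that unfolding sets_lborel_I sets_I by auto
    have "X \<inter> B = X \<inter> B \<inter> I\<^sub>\<beta>" using B by auto
    then have "X \<inter> B \<in> fmeasurable lborel" using fmeasurable_I[of "X \<inter> B"] B that by auto
    then show "emeasure ?L (X \<inter> B) = ennreal (measure lborel (X \<inter> B))"
      using B by (subst emeasure_restrict_space) (auto simp: emeasure_eq_measure2 I_eq)
  qed
  have "emeasure parry_measure B = (\<integral>\<^sup>+x. ennreal (parry_density x) * indicator B x \<partial>?L)"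
    unfolding parry_measure_def using assms by (subst emeasure_density) (auto simp: sets_lborel_I)
  also have "\<dots> = (\<integral>\<^sup>+x. ennreal c\<^sub>2 * indicator ({0..<1} \<inter> B) x
      + ennreal (c\<^sub>2 * (\<beta> - 1)) * indicator ({0..<1 / \<beta>} \<inter> B) x \<partial>?L)"
    using c2_pos by (intro nn_integral_cong)
      (auto simp: parry_density_def indicator_def ennreal_plus[symmetric] distrib_left simp del: ennreal_plus)
  also have "\<dots> = ennreal c\<^sub>2 * ennreal (measure lborel ({0..<1} \<inter> B))
      + ennreal (c\<^sub>2 * (\<beta> - 1)) * ennreal (measure lborel ({0..<1 / \<beta>} \<inter> B))"
    using em[of "{0..<1}"] em[of "{0..<1/\<beta>}"]
    by (simp add: nn_integral_add nn_integral_cmult_indicator)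
  also have "\<dots> = ennreal (parry_mass B)"
    using c2_pos by (simp add: parry_mass_def visit_def ennreal_mult[symmetric]
        ennreal_plus[symmetric] distrib_left mult.assoc del: ennreal_plus)
  finally show ?thesis .
qed

lemma acim_parry_measure: "greedy_acim parry_measure"
  unfolding greedy_acim_def
proof (intro conjI)
  let ?L = "restrict_space lborel I\<^sub>\<beta>"
  have sp: "space parry_measure = I\<^sub>\<beta>" using sets_eq_imp_space_eq[OF sets_parry_measure] by simp
  show "sets parry_measure = sets borel_I\<^sub>\<beta>" by (rule sets_parry_measure)
  have "parry_density \<in> borel_measurable ?L"
    unfolding parry_density_def[abs_def] by (intro measurable_restrict_space1) auto
  then show "absolutely_continuous ?L parry_measure"
    unfolding parry_measure_def by (intro absolutely_continuousI_density) auto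
  show "prob_space parry_measure"
  proof
    have "I\<^sub>\<beta> \<in> sets borel_I\<^sub>\<beta>" unfolding sets_I by (simp add: I_eq)
    moreover have "{0..<1} \<inter> I\<^sub>\<beta> = {0..<1}" "{0..<1 / \<beta>} \<inter> I\<^sub>\<beta> = {0..<1/\<beta>}"
      using beta_lt beta_gt by (auto simp: I_eq inv_beta)
    then have "parry_mass I\<^sub>\<beta> = 1" using c2_eq by (simp add: parry_mass_def visit_def)
    ultimately show "emeasure parry_measure (space parry_measure) = 1"
      by (simp add: sp emeasure_parry_measure)
  qed
  show "distr parry_measure borel_I\<^sub>\<beta> greedy_map = parry_measure"
  proof (rule measure_eqI)
    fix B assume "B \<in> sets (distr parry_measure borel_I\<^sub>\<beta> greedy_map)"
    then have B: "B \<in> sets borel_I\<^sub>\<beta>" by simp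
    then have B': "B \<in> sets borel" "B \<subseteq> I\<^sub>\<beta>" by (auto simp: sets_I)
    have m: "greedy_map -` B \<inter> I\<^sub>\<beta> \<in> sets borel_I\<^sub>\<beta>"
      using measurable_sets[OF greedy_measurable_I B] by simp
    \<comment> \<open>Invariance is the case of time 1 in \<open>parry_mass_invariant\<close>: a
      preimage observed at time 0 is the set observed at time 1.\<close>
    have "visit (greedy_map -` B \<inter> I\<^sub>\<beta>) 0 t = visit B (Suc 0) t" if "0 \<le> t" "t \<le> \<beta>" for t
      using that unfolding visit_def by (intro arg_cong[of _ _ "measure lborel"]) (auto simp: I_eq)
    then have "parry_mass (greedy_map -` B \<inter> I\<^sub>\<beta>) = parry_mass B"
      using parry_mass_invariant[OF B'(1), of "Suc 0"] beta_lt by (simp add: parry_mass_def inv_beta)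
    then show "emeasure (distr parry_measure borel_I\<^sub>\<beta> greedy_map) B = emeasure parry_measure B"
      using B m greedy_measurable_I
      by (subst emeasure_distr) (auto simp: measurable_cong_sets[OF sets_parry_measure refl] sp emeasure_parry_measure)
  qed (simp add: sets_parry_measure)
qed

lemma greedy_invariant_measure_eq: "greedy_invariant_measure = parry_measure"
  unfolding greedy_invariant_measure_def
proof (rule the_equality)
  fix \<mu> assume \<mu>: "greedy_acim \<mu>"
  then have "sets \<mu> = sets borel_I\<^sub>\<beta>" by (simp add: greedy_acim_def)
  then show "\<mu> = parry_measure" using sets_parry_measure
    by (intro measure_eqI) (auto simp: acim_eq_parry_mass[OF \<mu>] emeasure_parry_measure)
qed (rule acim_parry_measure)

lemma \<alpha>\<^sub>1_eq: "\<alpha>\<^sub>1 = 1 / (\<beta>\<^sup>2 + 1)"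
proof -
  have "{1 / \<beta>..1} \<in> sets borel_I\<^sub>\<beta>" using beta_gt unfolding sets_I by (auto simp: I_eq intro: inv_beta_le_nonneg)
  then have "\<alpha>\<^sub>1 = parry_mass {1 / \<beta>..1}"
    using emeasure_parry_measure[of "{1 / \<beta>..1}"] parry_mass_bounds[of "{1 / \<beta>..1}"]
    by (simp add: \<alpha>\<^sub>1_def greedy_invariant_measure_eq measure_def)
  also have "parry_mass {1 / \<beta>..1} = c\<^sub>2 * (1 - 1 / \<beta>)"
  proof -
    have "{0..<1} \<inter> {1 / \<beta>..1} = {1 / \<beta>..<1}" by (auto intro: inv_beta_le_nonneg)
    moreover have "{0..<1 / \<beta>} \<inter> {1 / \<beta>..1} = {}" by auto
    ultimately show ?thesis by (simp add: parry_mass_def visit_def)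
  qed
  also have "\<dots> = (\<beta>\<^sup>2 * (1 - 1 / \<beta>)) / (\<beta>\<^sup>2 + 1)" by (simp add: c\<^sub>2_def)
  also have "\<beta>\<^sup>2 * (1 - 1 / \<beta>) = 1" using beta_sq by (simp add: power2_eq_square field_simps)
  finally show ?thesis .
qed

lemma \<alpha>\<^sub>1_less: "\<alpha>\<^sub>1 < 5 / 18"
  using beta_gt beta_sq by (simp add: \<alpha>\<^sub>1_eq power2_eq_square field_simps)

section \<open>Coin tossing\<close>

definition coin_sign :: "(nat \<Rightarrow> nat) \<Rightarrow> nat \<Rightarrow> real" where
  "coin_sign a n = 2 * real (a n) - 1"

text \<open>A measure-preserving symmetry that takes the place of conditional expectations.
  Truncated subtraction swaps 0 and 1.\<close>

definition flip_coin :: "nat \<Rightarrow> (nat \<Rightarrow> nat) \<Rightarrow> nat \<Rightarrow> nat" where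
  "flip_coin n a = a(n := 1 - a n)"

lemma prob_coin: "prob_space (uniform_count_measure {0, 1::nat})"
  by (intro prob_space_uniform_count_measure) auto

lemma prob_space_coin_measure: "prob_space coin_measure"
  unfolding coin_measure_def by (intro prob_space_PiM prob_coin)

interpretation coin: prob_space coin_measure by (rule prob_space_coin_measure)

lemma space_coin_measure: "space coin_measure = {1..} \<rightarrow>\<^sub>E {0, 1}"
  by (simp add: coin_measure_def space_PiM space_uniform_count_measure)

lemma coin_cases: "a \<in> space coin_measure \<Longrightarrow> n \<ge> 1 \<Longrightarrow> a n = 0 \<or> a n = 1"
  by (auto simp: space_coin_measure PiE_iff)

lemma measurable_coin_component: "n \<ge> 1 \<Longrightarrow> (\<lambda>a. a n) \<in> coin_measure \<rightarrow>\<^sub>M count_space UNIV"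
proof -
  assume "n \<ge> 1"
  then have "(\<lambda>a. a n) \<in> coin_measure \<rightarrow>\<^sub>M uniform_count_measure {0, 1}"
    unfolding coin_measure_def by (intro measurable_component_singleton) simp
  moreover have "(\<lambda>x::nat. x) \<in> uniform_count_measure {0, 1} \<rightarrow>\<^sub>M count_space UNIV"
    by (subst measurable_cong_sets[where M'="count_space {0,1}"]) (auto simp: sets_uniform_count_measure)
  ultimately show ?thesis by (rule measurable_compose)
qed

lemma measurable_coin_Suc [measurable]: "(\<lambda>a. a (Suc n)) \<in> coin_measure \<rightarrow>\<^sub>M count_space UNIV"
  by (rule measurable_coin_component) simp

lemma measurable_sign [measurable]: "(\<lambda>a. coin_sign a (Suc n)) \<in> borel_measurable coin_measure"
  unfolding coin_sign_def by measurable

lemma sign_square: "a \<in> space coin_measure \<Longrightarrow> coin_sign a (Suc n) * coin_sign a (Suc n) = 1"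
  using coin_cases[of a "Suc n"] by (auto simp: coin_sign_def)

lemma flip_space: "n \<ge> 1 \<Longrightarrow> a \<in> space coin_measure \<Longrightarrow> flip_coin n a \<in> space coin_measure"
  using coin_cases[of a n] by (auto simp: space_coin_measure PiE_iff flip_coin_def extensional_def)

lemma sign_flip: "a \<in> space coin_measure \<Longrightarrow> n \<ge> 1 \<Longrightarrow> coin_sign (flip_coin n a) n = - coin_sign a n"
  using coin_cases[of a n] by (auto simp: flip_coin_def coin_sign_def)

lemma flip_measurable: "n \<ge> 1 \<Longrightarrow> flip_coin n \<in> coin_measure \<rightarrow>\<^sub>M coin_measure"
proof -
  assume n: "n \<ge> 1"
  let ?U = "uniform_count_measure {0, 1::nat}"
  have "(\<lambda>a. \<lambda>i\<in>{1..}. flip_coin n a i) \<in> coin_measure \<rightarrow>\<^sub>M (\<Pi>\<^sub>M i\<in>{1..}. ?U)"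
  proof (rule measurable_restrict)
    fix i :: nat assume i: "i \<in> {1..}"
    have c: "(\<lambda>a. a i) \<in> coin_measure \<rightarrow>\<^sub>M ?U" using i unfolding coin_measure_def by measurable
    have "(\<lambda>x. 1 - x) \<in> ?U \<rightarrow>\<^sub>M ?U"
      by (auto simp: measurable_def space_uniform_count_measure sets_uniform_count_measure)
    with c have "(\<lambda>a. 1 - a i) \<in> coin_measure \<rightarrow>\<^sub>M ?U" by (rule measurable_compose)
    with c show "(\<lambda>a. flip_coin n a i) \<in> coin_measure \<rightarrow>\<^sub>M ?U"
      by (cases "i = n") (auto simp: flip_coin_def)
  qed
  moreover have "flip_coin n a = (\<lambda>i\<in>{1..}. flip_coin n a i)" if "a \<in> space coin_measure" for a
    using flip_space[OF n that] by (auto simp: space_coin_measure PiE_iff extensional_def)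
  ultimately show ?thesis
    by (subst measurable_cong[where g="\<lambda>a. \<lambda>i\<in>{1..}. flip_coin n a i"]) (auto simp: coin_measure_def)
qed

text \<open>It is enough to compare cylinders. Flipping replaces one side of a cylinder by its
  mirror image, which has as many points and hence the same uniform measure.\<close>

lemma distr_flip:
  assumes n: "n \<ge> 1"
  shows "distr coin_measure coin_measure (flip_coin n) = coin_measure"
proof -
  let ?U = "uniform_count_measure {0, 1::nat}"
  have "distr coin_measure coin_measure (flip_coin n) = (\<Pi>\<^sub>M i\<in>{1..}. ?U)"
  proof (rule measure_eqI_PiM_infinite)
    show "finite_measure (distr coin_measure coin_measure (flip_coin n))"
      by (intro prob_space.finite_measure coin.prob_space_distr flip_measurable n)
    fix J :: "nat set" and A :: "nat \<Rightarrow> nat set"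
    assume J: "finite J" "J \<subseteq> {1..}" and A: "\<And>i. i \<in> J \<Longrightarrow> A i \<in> sets ?U"
    define A' where "A' i = (if i = n then (\<lambda>x. 1 - x) -` A i \<inter> {0, 1} else A i)" for i
    have A': "A' i \<in> sets ?U" if "i \<in> J" for i
      using A[OF that] by (auto simp: A'_def sets_uniform_count_measure)
    have em: "emeasure ?U (A' i) = emeasure ?U (A i)" if "i \<in> J" for i
    proof (cases "i = n")
      case True
      have "A i \<subseteq> {0, 1}" using A[OF that] by (auto simp: sets_uniform_count_measure)
      then have "bij_betw (\<lambda>x. 1 - x) (A' i) (A i)"
        unfolding A'_def using True by (intro bij_betwI[where g="\<lambda>x. 1 - x"]) auto
      then have "card (A' i) = card (A i)" by (rule bij_betw_same_card)
      then show ?thesis using A[OF that] A'[OF that]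
        by (simp add: emeasure_uniform_count_measure sets_uniform_count_measure)
    qed (simp add: A'_def)
    let ?E = "prod_emb {1..} (\<lambda>_. ?U) J (Pi\<^sub>E J A)"
    have E: "?E \<in> sets coin_measure" unfolding coin_measure_def
      using J A by (intro sets_PiM_I) auto
    have "emeasure (distr coin_measure coin_measure (flip_coin n)) ?E
        = emeasure coin_measure (flip_coin n -` ?E \<inter> space coin_measure)"
      by (rule emeasure_distr[OF flip_measurable[OF n] E])
    also have "flip_coin n -` ?E \<inter> space coin_measure = prod_emb {1..} (\<lambda>_. ?U) J (Pi\<^sub>E J A')"
    proof (intro set_eqI)
      fix a
      have "a \<in> prod_emb {1..} (\<lambda>_. ?U) J (Pi\<^sub>E J X) \<longleftrightarrow> a \<in> space coin_measure \<and> (\<forall>i\<in>J. a i \<in> X i)" for a X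
        using J by (auto simp: prod_emb_def space_coin_measure space_uniform_count_measure PiE_iff)
      moreover have "flip_coin n a i \<in> A i \<longleftrightarrow> a i \<in> A' i" if "a \<in> space coin_measure" "i \<in> J" for i
        using coin_cases[OF that(1), of i] J that(2) by (auto simp: flip_coin_def A'_def)
      ultimately show "a \<in> flip_coin n -` ?E \<inter> space coin_measure \<longleftrightarrow> a \<in> prod_emb {1..} (\<lambda>_. ?U) J (Pi\<^sub>E J A')"
        using flip_space[OF n, of a] by auto
    qed
    also have "emeasure coin_measure (prod_emb {1..} (\<lambda>_. ?U) J (Pi\<^sub>E J A')) = (\<Prod>i\<in>J. emeasure ?U (A' i))"
      unfolding coin_measure_def using J A' prob_coin by (intro emeasure_PiM_emb) auto
    also have "\<dots> = (\<Prod>i\<in>J. emeasure ?U (A i))" using em by simp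
    also have "\<dots> = emeasure (Pi\<^sub>M {1..} (\<lambda>_. ?U)) ?E"
      using J A prob_coin by (intro emeasure_PiM_emb[symmetric]) auto
    finally show "emeasure (distr coin_measure coin_measure (flip_coin n)) ?E = emeasure (Pi\<^sub>M {1..} (\<lambda>_. ?U)) ?E" .
  qed (simp_all add: coin_measure_def)
  then show ?thesis by (simp add: coin_measure_def)
qed

text \<open>The value at \<open>a\<close> depends on \<open>a\<^sub>1, \<dots>, a\<^sub>m\<close> only (as far as flips of single coins can tell).\<close>

definition determined :: "nat \<Rightarrow> ((nat \<Rightarrow> nat) \<Rightarrow> 'b) \<Rightarrow> bool" where
  "determined m f \<longleftrightarrow> (\<forall>n a. n > m \<longrightarrow> f (flip_coin n a) = f a)"

text \<open>Flipping coin \<open>Suc m\<close> preserves the measure and \<open>f\<close> but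
  negates the sign, so the expectation equals its own negative. This is the martingale difference
  property.\<close>

lemma expectation_predictable_sign:
  assumes [measurable]: "f \<in> borel_measurable coin_measure" and "determined m f"
  shows "coin.expectation (\<lambda>a. f a * coin_sign a (Suc m)) = 0"
proof -
  have fl: "flip_coin (Suc m) \<in> coin_measure \<rightarrow>\<^sub>M coin_measure" by (rule flip_measurable) simp
  have "coin.expectation (\<lambda>a. f a * coin_sign a (Suc m))
      = integral\<^sup>L (distr coin_measure coin_measure (flip_coin (Suc m))) (\<lambda>a. f a * coin_sign a (Suc m))"
    by (subst distr_flip) auto
  also have "\<dots> = coin.expectation (\<lambda>a. f (flip_coin (Suc m) a) * coin_sign (flip_coin (Suc m) a) (Suc m))"
    by (rule integral_distr[OF fl]) measurable
  also have "\<dots> = coin.expectation (\<lambda>a. - (f a * coin_sign a (Suc m)))"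
    using assms(2) by (intro Bochner_Integration.integral_cong) (auto simp: sign_flip determined_def)
  finally show ?thesis by simp
qed

lemma coin_integrable_bounded:
  assumes "f \<in> borel_measurable coin_measure" "\<And>a. a \<in> space coin_measure \<Longrightarrow> \<bar>f a\<bar> \<le> B"
  shows "integrable coin_measure (f :: _ \<Rightarrow> real)"
  using assms by (intro coin.integrable_const_bound[where B=B]) auto

section \<open>A strong law for sums of martingale differences\<close>

lemma summable_expectation_imp_tendsto_zero:
  fixes f :: "nat \<Rightarrow> (nat \<Rightarrow> nat) \<Rightarrow> real"
  assumes int: "\<And>n. integrable coin_measure (f n)"
    and nonneg: "\<And>n a. 0 \<le> f n a"
    and s: "summable (\<lambda>n. coin.expectation (f n))"
  shows "AE a in coin_measure. (\<lambda>n. f n a) \<longlonglongrightarrow> 0"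
proof -
  have [measurable]: "f n \<in> borel_measurable coin_measure" for n using int by auto
  have "(\<integral>\<^sup>+a. (\<Sum>n. ennreal (f n a)) \<partial>coin_measure) = (\<Sum>n. \<integral>\<^sup>+a. ennreal (f n a) \<partial>coin_measure)"
    by (rule nn_integral_suminf) measurable
  also have "\<dots> = (\<Sum>n. ennreal (coin.expectation (f n)))"
    using nonneg int by (simp add: nn_integral_eq_integral)
  also have "\<dots> = ennreal (\<Sum>n. coin.expectation (f n))"
    using s nonneg by (intro suminf_ennreal2) auto
  also have "\<dots> \<noteq> \<infinity>" by simp
  finally have "(\<integral>\<^sup>+a. (\<Sum>n. ennreal (f n a)) \<partial>coin_measure) \<noteq> \<infinity>" .
  then have "AE a in coin_measure. (\<Sum>n. ennreal (f n a)) \<noteq> \<infinity>"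
    by (intro nn_integral_PInf_AE) auto
  then show ?thesis
  proof eventually_elim
    case (elim a)
    then have "summable (\<lambda>n. f n a)" using nonneg by (intro summable_suminf_not_top) auto
    then show ?case by (rule summable_LIMSEQ_zero)
  qed
qed

lemma tendsto_zero_of_power4:
  fixes f :: "nat \<Rightarrow> real"
  assumes "(\<lambda>n. f n ^ 4) \<longlonglongrightarrow> 0"
  shows "f \<longlonglongrightarrow> 0"
proof -
  have "(\<lambda>n. root 4 (f n ^ 4)) \<longlonglongrightarrow> root 4 0" by (intro tendsto_intros assms)
  moreover have "root 4 (x ^ 4) = \<bar>x\<bar>" for x :: real
    using real_root_power_cancel[of 4 "\<bar>x\<bar>"] by simp
  ultimately show ?thesis by (intro tendsto_rabs_zero_cancel[of f]) simp
qed

text \<open>Fourth moments rather than second ones, so that the bound \<open>9 C / n\<^sup>2\<close> for the averages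
  is summable along all \<open>n\<close> and no passage through a subsequence is needed.\<close>

lemma predictable_lln:
  fixes h :: "nat \<Rightarrow> (nat \<Rightarrow> nat) \<Rightarrow> real"
  assumes meas [measurable]: "\<And>m. h m \<in> borel_measurable coin_measure"
    and det: "\<And>m. determined m (h m)"
    and bdd: "\<And>m a. a \<in> space coin_measure \<Longrightarrow> \<bar>h m a\<bar> \<le> real m + 1"
    and mom: "\<And>m. coin.expectation (\<lambda>a. h m a ^ 4) \<le> C"
  shows "AE a in coin_measure. (\<lambda>n. (\<Sum>m<n. h m a * coin_sign a (Suc m)) / real n) \<longlonglongrightarrow> 0"
proof -
  define S where "S n a = (\<Sum>m<n. h m a * coin_sign a (Suc m))" for n a
  have [measurable]: "S n \<in> borel_measurable coin_measure" for n
    unfolding S_def by measurable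
  have sign1: "\<bar>coin_sign a (Suc m)\<bar> = 1" if "a \<in> space coin_measure" for a m
    using coin_cases[OF that, of "Suc m"] by (auto simp: coin_sign_def)
  \<comment> \<open>This crude bound serves only for integrability.\<close>
  have Sb: "\<bar>S n a\<bar> \<le> real n * real n" if "a \<in> space coin_measure" for n a
  proof -
    have "\<bar>S n a\<bar> \<le> (\<Sum>m<n. \<bar>h m a * coin_sign a (Suc m)\<bar>)" unfolding S_def by (rule sum_abs)
    also have "\<dots> \<le> (\<Sum>m<n. real n)"
    proof (rule sum_mono)
      fix m assume "m \<in> {..<n}"
      with bdd[OF that, of m] show "\<bar>h m a * coin_sign a (Suc m)\<bar> \<le> real n" by (simp add: abs_mult sign1[OF that])
    qed
    finally show ?thesis by simp
  qed
  have detS: "determined n (S n)" for n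
    using det unfolding determined_def S_def
    by (intro allI impI sum.cong refl) (auto simp: coin_sign_def flip_coin_def)
  have C0: "C \<ge> 0"
    by (rule order_trans[OF _ mom[of 0]]) (intro Bochner_Integration.integral_nonneg, simp)
  have int: "integrable coin_measure (\<lambda>a. S n a ^ p * h n a ^ q * coin_sign a (Suc n) ^ r)" for n p q r
  proof (rule coin_integrable_bounded)
    fix a assume a: "a \<in> space coin_measure"
    show "\<bar>S n a ^ p * h n a ^ q * coin_sign a (Suc n) ^ r\<bar> \<le> (real n * real n) ^ p * (real n + 1) ^ q * 1 ^ r"
      unfolding abs_mult power_abs using Sb[OF a, of n] bdd[OF a, of n] sign1[OF a, of n]
      by (intro mult_mono power_mono) auto
  qed measurable
  have int': "integrable coin_measure (\<lambda>a. S n a ^ p * h n a ^ q)" for n p q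
    using int[of n p q 0] by simp
  have moment: "coin.expectation (\<lambda>a. S n a ^ 4) \<le> 9 * C * (real n)\<^sup>2" for n
  proof (induction n)
    case (Suc n)
    \<comment> \<open>\<open>S n\<close> and \<open>h n\<close> depend on the first \<open>n\<close>
      coins only, so the terms of the binomial expansion that are odd in the new sign have mean
      zero.\<close>
    have odd: "coin.expectation (\<lambda>a. S n a ^ p * h n a ^ q * coin_sign a (Suc n)) = 0" for p q
      using det[of n] detS[of n] by (intro expectation_predictable_sign) (auto simp: determined_def)
    have "S (Suc n) a ^ 4 = S n a ^ 4 + 4 * (S n a ^ 3 * h n a ^ 1 * coin_sign a (Suc n))
        + 6 * (S n a ^ 2 * h n a ^ 2) + 4 * (S n a ^ 1 * h n a ^ 3 * coin_sign a (Suc n)) + h n a ^ 4"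
      if "a \<in> space coin_measure" for a
    proof -
      have "S (Suc n) a = S n a + h n a * coin_sign a (Suc n)" by (simp add: S_def)
      moreover have "(s + h * e) ^ 4 = s ^ 4 + 4 * (s ^ 3 * h ^ 1 * e) + 6 * (s ^ 2 * h ^ 2) + 4 * (s ^ 1 * h ^ 3 * e) + h ^ 4"
        if "e * e = 1" for s h e :: real
        using that by algebra
      ultimately show ?thesis using sign_square[OF that, of n] by metis
    qed
    then have "coin.expectation (\<lambda>a. S (Suc n) a ^ 4)
      = coin.expectation (\<lambda>a. S n a ^ 4 + 4 * (S n a ^ 3 * h n a ^ 1 * coin_sign a (Suc n))
        + 6 * (S n a ^ 2 * h n a ^ 2) + 4 * (S n a ^ 1 * h n a ^ 3 * coin_sign a (Suc n)) + h n a ^ 4)"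
      by (intro Bochner_Integration.integral_cong) auto
    also have "\<dots> = coin.expectation (\<lambda>a. S n a ^ 4) + 6 * coin.expectation (\<lambda>a. S n a ^ 2 * h n a ^ 2)
        + coin.expectation (\<lambda>a. h n a ^ 4)"
      using int[of n 3 1 1] int[of n 1 3 1] int'[of n 4 0] int'[of n 2 2] int'[of n 0 4] odd[of 3 1] odd[of 1 3]
      by simp
    finally have step: "coin.expectation (\<lambda>a. S (Suc n) a ^ 4) = coin.expectation (\<lambda>a. S n a ^ 4)
        + 6 * coin.expectation (\<lambda>a. S n a ^ 2 * h n a ^ 2) + coin.expectation (\<lambda>a. h n a ^ 4)" .
    show ?case
    proof (cases "n = 0")
      case True
      then show ?thesis using step mom[of n] C0 by (simp add: S_def power2_eq_square)
    next
      case False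
      have "coin.expectation (\<lambda>a. 6 * (S n a ^ 2 * h n a ^ 2))
          \<le> coin.expectation (\<lambda>a. S n a ^ 4 / real n + 9 * real n * h n a ^ 4)"
      proof (rule integral_mono)
        fix a
        \<comment> \<open>The weight 3n balances the two bounds: each contributes 9Cn, and 18Cn + C
          fits below 9C((n+1)^2 - n^2) = 18Cn + 9C.\<close>
        have "0 \<le> (S n a ^ 2 - 3 * real n * h n a ^ 2)\<^sup>2 / real n" by simp
        also have "\<dots> = S n a ^ 4 / real n + 9 * real n * h n a ^ 4 - 6 * (S n a ^ 2 * h n a ^ 2)"
          using False by (simp add: field_simps power2_eq_square power4_eq_xxxx)
        finally show "6 * (S n a ^ 2 * h n a ^ 2) \<le> S n a ^ 4 / real n + 9 * real n * h n a ^ 4" by simp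
      qed (use int'[of n 2 2] int'[of n 4 0] int'[of n 0 4] in auto)
      also have "\<dots> = coin.expectation (\<lambda>a. S n a ^ 4) / real n + 9 * real n * coin.expectation (\<lambda>a. h n a ^ 4)"
        using int'[of n 4 0] int'[of n 0 4] by simp
      also have "\<dots> \<le> (9 * C * (real n)\<^sup>2) / real n + 9 * real n * C"
        using Suc mom[of n] by (intro add_mono divide_right_mono mult_left_mono) auto
      also have "\<dots> = 18 * C * real n" using False by (simp add: power2_eq_square)
      finally have "6 * coin.expectation (\<lambda>a. S n a ^ 2 * h n a ^ 2) \<le> 18 * C * real n" by simp
      then have "coin.expectation (\<lambda>a. S (Suc n) a ^ 4) \<le> 9 * C * (real n)\<^sup>2 + 18 * C * real n + C"
        using step Suc mom[of n] by simp
      also have "\<dots> \<le> 9 * C * (real (Suc n))\<^sup>2" using C0 by (simp add: power2_eq_square algebra_simps)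
      finally show ?thesis .
    qed
  qed (simp add: S_def)
  have "AE a in coin_measure. (\<lambda>n. (S n a / real n) ^ 4) \<longlonglongrightarrow> 0"
  proof (rule summable_expectation_imp_tendsto_zero)
    show "integrable coin_measure (\<lambda>a. (S n a / real n) ^ 4)" for n
      using int'[of n 4 0] by (simp add: power_divide)
    have sm: "summable (\<lambda>n. 9 * C * (1 / (real n)\<^sup>2))"
      using inverse_power_summable[of 2, where 'a=real] by (intro summable_mult) (simp add: field_simps)
    show "summable (\<lambda>n. coin.expectation (\<lambda>a. (S n a / real n) ^ 4))"
    proof (rule summable_comparison_test'[OF sm, of 0])
      fix n :: nat
      have "coin.expectation (\<lambda>a. (S n a / real n) ^ 4) = coin.expectation (\<lambda>a. S n a ^ 4) / real n ^ 4"
        by (simp add: power_divide)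
      also have "\<dots> \<le> (9 * C * (real n)\<^sup>2) / real n ^ 4" by (intro divide_right_mono moment) auto
      also have "\<dots> = 9 * C * (1 / (real n)\<^sup>2)" by (cases "n = 0") (auto simp: field_simps power2_eq_square power4_eq_xxxx)
      finally show "norm (coin.expectation (\<lambda>a. (S n a / real n) ^ 4)) \<le> 9 * C * (1 / (real n)\<^sup>2)"
        by (simp add: Bochner_Integration.integral_nonneg)
    qed
  qed simp
  then show ?thesis
  proof eventually_elim
    case (elim a)
    then show ?case unfolding S_def by (rule tendsto_zero_of_power4)
  qed
qed

section \<open>Normalising coin sequences\<close>

text \<open>
  The transducer reads the coin digits and writes the greedy digits with a delay. In state \<open>Lead\<close>
  only ones have been read, and all of them are written. In state \<open>Even k\<close> the
  word \<open>0(10)\<^sup>k\<close> has been read but not yet written, in state \<open>Odd k\<close> the word \<open>0(10)\<^sup>k1\<close>.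
  Reading \<open>0\<close> in state \<open>Even k\<close> releases \<open>0(10)\<^sup>k\<close>, the new \<open>0\<close> being withheld. Reading \<open>1\<close> in
  state \<open>Odd k\<close> gives \<open>0(10)\<^sup>k11\<close>, which has the same value as \<open>10\<^bsup>2k+2\<^esup>\<close>; all of
  this but the last \<open>0\<close> is released.
\<close>

datatype carry = Lead | Even nat | Odd nat

instance carry :: countable
  by countable_datatype

primrec carry_step :: "carry \<Rightarrow> nat \<Rightarrow> carry" where
  "carry_step Lead b = (if b = 0 then Even 0 else Lead)"
| "carry_step (Even k) b = (if b = 0 then Even 0 else Odd k)"
| "carry_step (Odd k) b = (if b = 0 then Even (Suc k) else Even 0)"

primrec carry_state :: "(nat \<Rightarrow> nat) \<Rightarrow> nat \<Rightarrow> carry" where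
  "carry_state a 0 = Lead"
| "carry_state a (Suc n) = carry_step (carry_state a n) (a (Suc n))"

text \<open>The number of ones released when \<open>b\<close> is read.\<close>

primrec emitted :: "carry \<Rightarrow> nat \<Rightarrow> nat" where
  "emitted Lead b = b"
| "emitted (Even k) b = (if b = 0 then k else 0)"
| "emitted (Odd k) b = (if b = 0 then 0 else 1)"

text \<open>The length of the withheld word.\<close>

primrec held :: "carry \<Rightarrow> nat" where
  "held Lead = 0"
| "held (Even k) = 2 * k + 1"
| "held (Odd k) = 2 * k + 2"

text \<open>The value of the digit sequence that consists of \<open>0(10)\<^sup>k\<close> followed by a sequence of value \<open>z\<close>.\<close>

primrec alternating :: "nat \<Rightarrow> real \<Rightarrow> real" where
  "alternating 0 z = z / \<beta>"
| "alternating (Suc k) z = (1 / \<beta> + alternating k z / \<beta>) / \<beta>"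

text \<open>The point still to be expanded: the withheld word followed by an unread tail of value
  \<open>z\<close>.\<close>

primrec carry_value :: "carry \<Rightarrow> real \<Rightarrow> real" where
  "carry_value Lead z = z"
| "carry_value (Even k) z = alternating k z"
| "carry_value (Odd k) z = alternating k ((1 + z) / \<beta>)"

section \<open>Greedy expansions of the released words\<close>

definition greedy_run :: "real \<Rightarrow> nat \<Rightarrow> real \<Rightarrow> nat \<Rightarrow> bool" where
  "greedy_run x n y s \<longleftrightarrow> (greedy_map ^^ n) x = y \<and> (\<Sum>k=1..n. greedy_digit x k) = s"

lemma greedy_run_0: "greedy_run x 0 x 0"
  by (simp add: greedy_run_def)

lemma greedy_run_add:
  assumes "greedy_run x n y s" "greedy_run y n' y' s'"
  shows "greedy_run x (n + n') y' (s + s')"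
proof -
  have "greedy_digit x (k + n) = greedy_digit y k" if "k \<ge> 1" for k
  proof -
    have "k + n - 1 = (k - 1) + n" using that by simp
    then show ?thesis using assms(1) by (simp add: greedy_digit_def greedy_run_def funpow_add)
  qed
  then have "(\<Sum>k=1 + n..n' + n. greedy_digit x k) = s'"
    using assms(2) by (subst sum.shift_bounds_cl_nat_ivl) (simp add: greedy_run_def)
  moreover have "(\<Sum>k=1..n + n'. greedy_digit x k) = (\<Sum>k=1..n. greedy_digit x k) + (\<Sum>k=1 + n..n' + n. greedy_digit x k)"
    by (subst sum.ub_add_nat) (auto simp: add.commute)
  moreover have "(greedy_map ^^ (n + n')) x = y'"
    using assms by (simp add: greedy_run_def add.commute[of n] funpow_add)
  ultimately show ?thesis using assms(1) by (simp add: greedy_run_def)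
qed

lemma greedy_run_zero_digit: "y < 1 / \<beta> \<Longrightarrow> greedy_run y 1 (\<beta> * y) 0"
  by (simp add: greedy_run_def greedy_map_def greedy_digit_def)

lemma greedy_run_one_digit: "1 / \<beta> \<le> y \<Longrightarrow> greedy_run y 1 (\<beta> * y - 1) 1"
  by (simp add: greedy_run_def greedy_map_def greedy_digit_def)

text \<open>The elementary carry 011 = 100 in base \<beta>.\<close>

lemma inv_beta_sum: "1 / \<beta> + 1 / \<beta> / \<beta> = 1"
proof -
  have "1 / \<beta> + 1 / \<beta> / \<beta> = (1 + 1 / \<beta>) / \<beta>" by (simp only: add_divide_distrib)
  also have "\<dots> = 1" by (simp add: inv_beta)
  finally show ?thesis .
qed

lemma alternating_nonneg: "0 \<le> z \<Longrightarrow> 0 \<le> alternating k z"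
  by (induction k) auto

text \<open>For \<open>z = 1\<close> the value is 1/\<beta> for every \<open>k\<close>, by the
  elementary carry; a smaller \<open>z\<close> stays strictly below, so the greedy digit is
  0.\<close>

lemma alternating_less: "z < 1 \<Longrightarrow> alternating k z < 1 / \<beta>"
proof (induction k)
  case (Suc k)
  have "1 / \<beta> + alternating k z / \<beta> < 1 / \<beta> + 1 / \<beta> / \<beta>"
    using Suc by (intro add_strict_left_mono divide_strict_right_mono) auto
  also have "\<dots> = 1" by (rule inv_beta_sum)
  finally show ?case by (simp add: divide_strict_right_mono)
qed (simp add: divide_strict_right_mono)

text \<open>This is the step from \<open>Odd k\<close> to \<open>Even (Suc k)\<close> on reading 0:
  a final 10 joins the withheld word.\<close>

lemma alternating_snoc: "alternating k ((1 + z / \<beta>) / \<beta>) = alternating (Suc k) z"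
  by (induction k) (simp_all add: add_divide_distrib)

text \<open>The carry 0(10)^k 11 = 10^(2k+2), followed by a tail \<open>z\<close> after 2k+3 digits.
  Carrying out the inner word puts a 1 behind the leading 01, which triggers the next elementary
  carry.\<close>

lemma alternating_carry:
  "alternating k ((1 + (1 + z) / \<beta>) / \<beta>) = 1 / \<beta> + z / \<beta> ^ (2 * k + 3)"
proof (induction k)
  case 0
  have "alternating 0 ((1 + (1 + z) / \<beta>) / \<beta>) = (1 / \<beta> + 1 / \<beta> / \<beta>) / \<beta> + z / \<beta> / \<beta> / \<beta>"
    by (simp only: alternating.simps add_divide_distrib add.assoc)
  also have "\<dots> = 1 / \<beta> + z / \<beta> / \<beta> / \<beta>" by (simp only: inv_beta_sum)
  finally show ?case by (simp add: power3_eq_cube)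
next
  case (Suc k)
  have "alternating (Suc k) ((1 + (1 + z) / \<beta>) / \<beta>) = (1 / \<beta> + 1 / \<beta> / \<beta>) / \<beta> + z / \<beta> ^ (2 * k + 3) / \<beta> / \<beta>"
    unfolding alternating.simps(2) Suc by (simp only: add_divide_distrib add.assoc)
  also have "\<dots> = 1 / \<beta> + z / \<beta> ^ (2 * k + 3) / \<beta> / \<beta>" by (simp only: inv_beta_sum)
  also have "\<dots> = 1 / \<beta> + z / \<beta> ^ (2 * Suc k + 3)" by (simp add: numeral_eq_Suc)
  finally show ?case .
qed

lemma greedy_run_alternating:
  assumes "0 \<le> z" "z < 1"
  shows "greedy_run (alternating k z) (2 * k + 1) z k"
proof (induction k)
  case 0
  show ?case using greedy_run_zero_digit[OF alternating_less[OF assms(2), of 0]] by simp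
next
  case (Suc k)
  let ?y = "1 / \<beta> + alternating k z / \<beta>"
  have "greedy_run (alternating (Suc k) z) 1 ?y 0"
    using greedy_run_zero_digit[OF alternating_less[OF assms(2), of "Suc k"]] by simp
  moreover have "greedy_run ?y 1 (alternating k z) 1"
    using greedy_run_one_digit[of ?y] alternating_nonneg[OF assms(1), of k] by (simp add: distrib_left)
  ultimately have "greedy_run (alternating (Suc k) z) (1 + 1) (alternating k z) (0 + 1)"
    by (rule greedy_run_add)
  from greedy_run_add[OF this Suc] show ?case by simp
qed

lemma greedy_run_zeros:
  assumes "0 \<le> z" "z < \<beta>"
  shows "greedy_run (z / \<beta> ^ (j + 1)) j (z / \<beta>) 0"
proof (induction j)
  case (Suc j)
  have "z / \<beta> ^ (Suc j + 1) < \<beta> / \<beta> ^ (Suc j + 1)"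
    using assms by (intro divide_strict_right_mono) auto
  also have "\<dots> = (1 / \<beta>) ^ Suc j" by (simp add: field_simps)
  also have "\<dots> \<le> 1 / \<beta>" using power_decreasing[of 1 "Suc j" "1 / \<beta>"] by simp
  finally have "greedy_run (z / \<beta> ^ (Suc j + 1)) 1 (\<beta> * (z / \<beta> ^ (Suc j + 1))) 0" by (rule greedy_run_zero_digit)
  from greedy_run_add[OF this, of j "z / \<beta>" 0] Suc show ?case by simp
qed (simp add: greedy_run_0)

text \<open>Only 2k+2 digits are taken, a 1 and 2k+1 zeros. The last 0 of the carried word stays
  withheld, whence the end point \<open>z / \<beta>\<close>, the value of state
  \<open>Even 0\<close>.\<close>

lemma greedy_run_carry:
  assumes "0 \<le> z" "z < \<beta>"
  shows "greedy_run (alternating k ((1 + (1 + z) / \<beta>) / \<beta>)) (2 * k + 2) (z / \<beta>) 1"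
proof -
  let ?y = "1 / \<beta> + z / \<beta> ^ (2 * k + 3)"
  have "greedy_run ?y 1 (\<beta> * ?y - 1) 1" using assms by (intro greedy_run_one_digit) simp
  moreover have "\<beta> * ?y - 1 = z / \<beta> ^ ((2 * k + 1) + 1)"
    by (simp add: distrib_left power3_eq_cube power_add)
  ultimately have "greedy_run ?y 1 (z / \<beta> ^ ((2 * k + 1) + 1)) 1" by simp
  from greedy_run_add[OF this greedy_run_zeros[OF assms]] show ?thesis by (simp add: alternating_carry)
qed

section \<open>Correctness of the transducer\<close>

definition tail_value :: "(nat \<Rightarrow> nat) \<Rightarrow> nat \<Rightarrow> real" where
  "tail_value a m = expansion_value (\<lambda>j. a (j + m))"

lemma geometric_beta: "(\<lambda>i. 1 / \<beta> ^ Suc i) sums \<beta>"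
proof -
  have "(\<lambda>i. (1 / \<beta>) * (1 / \<beta>) ^ i) sums ((1 / \<beta>) * (1 / (1 - 1 / \<beta>)))"
    by (intro sums_mult geometric_sums) simp
  moreover have "(1 / \<beta>) * (1 / (1 - 1 / \<beta>)) = \<beta>"
    using inv_beta_minus by (simp add: field_simps)
  ultimately show ?thesis by (simp add: power_divide)
qed

context
  fixes a :: "nat \<Rightarrow> nat"
  assumes a: "a \<in> space coin_measure"
begin

lemma digit_le: "real (a (Suc n)) \<le> 1"
  using coin_cases[OF a, of "Suc n"] by auto

lemma summable_tail: "summable (\<lambda>i. real (a (Suc i + m)) / \<beta> ^ Suc i)"
  by (rule summable_comparison_test'[OF sums_summable[OF geometric_beta], of 0])
    (use digit_le in \<open>auto intro!: divide_right_mono\<close>)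

lemma tail_value_bounds: "0 \<le> tail_value a m" "tail_value a m \<le> \<beta>"
proof -
  show "0 \<le> tail_value a m" unfolding tail_value_def expansion_value_def
    by (rule suminf_nonneg[OF summable_tail]) simp
  have "tail_value a m \<le> (\<Sum>i. 1 / \<beta> ^ Suc i)" unfolding tail_value_def expansion_value_def
    using digit_le by (intro suminf_le summable_tail sums_summable[OF geometric_beta] divide_right_mono) auto
  then show "tail_value a m \<le> \<beta>" using sums_unique[OF geometric_beta] by simp
qed

lemma tail_value_Suc: "tail_value a m = (real (a (Suc m)) + tail_value a (Suc m)) / \<beta>"
proof -
  have "tail_value a m = (\<Sum>i. real (a (Suc (Suc i) + m)) / \<beta> ^ Suc (Suc i)) + real (a (Suc 0 + m)) / \<beta> ^ Suc 0"
    unfolding tail_value_def expansion_value_def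
    using suminf_split_head[OF summable_tail[of m]] by simp
  also have "(\<Sum>i. real (a (Suc (Suc i) + m)) / \<beta> ^ Suc (Suc i)) = (\<Sum>i. real (a (Suc i + Suc m)) / \<beta> ^ Suc i / \<beta>)"
    by (simp add: field_simps)
  also have "\<dots> = tail_value a (Suc m) / \<beta>"
    unfolding tail_value_def expansion_value_def by (rule suminf_divide[OF summable_tail])
  finally show ?thesis by (simp add: add_divide_distrib)
qed

text \<open>The maximal value \<beta> needs all digits to be 1. Strictness is passed back from the
  position of a zero through \<beta>^2 = \<beta> + 1.\<close>

lemma tail_value_less: "a (Suc (m + j)) = 0 \<Longrightarrow> tail_value a m < \<beta>"
proof (induction j arbitrary: m)
  case 0
  have "tail_value a (Suc m) < \<beta> * \<beta>" using tail_value_bounds[of "Suc m"] by (simp add: beta_sq)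
  then show ?case using 0 tail_value_Suc[of m] by (simp add: pos_divide_less_eq)
next
  case (Suc j)
  then have "tail_value a (Suc m) < \<beta>" by simp
  then have "real (a (Suc m)) + tail_value a (Suc m) < \<beta> * \<beta>" using digit_le[of m] by (simp add: beta_sq)
  then show ?case using tail_value_Suc[of m] by (simp add: pos_divide_less_eq)
qed

text \<open>Recurring zeros keep all tails strictly below \<beta>, so the rewritten words are the
  greedy ones. By induction the released part is an initial run of the greedy expansion.\<close>

lemma greedy_run_transducer:
  assumes zeros: "\<And>m. \<exists>j. a (Suc (m + j)) = 0"
  shows "\<exists>n. n + held (carry_state a m) = m \<and>
     greedy_run (expansion_value a) n (carry_value (carry_state a m) (tail_value a m))
       (\<Sum>i<m. emitted (carry_state a i) (a (Suc i)))"
proof (induction m)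
  case 0
  show ?case by (simp add: greedy_run_0 tail_value_def)
next
  case (Suc m)
  then obtain n where n: "n + held (carry_state a m) = m" and
    run: "greedy_run (expansion_value a) n (carry_value (carry_state a m) (tail_value a m))
       (\<Sum>i<m. emitted (carry_state a i) (a (Suc i)))" by auto
  let ?z = "tail_value a (Suc m)"
  have z: "0 \<le> ?z" "?z < \<beta>" using tail_value_bounds tail_value_less zeros by blast+
  have z1: "0 \<le> ?z / \<beta>" "?z / \<beta> < 1" using z by auto
  have b: "a (Suc m) = 0 \<or> a (Suc m) = 1" using coin_cases[OF a] by simp
  \<comment> \<open>A single reading step suffices: withheld length plus the digit read splits into
    released and still withheld digits, and runs concatenate.\<close>
  have "\<exists>n'. n' + held (carry_state a (Suc m)) = held (carry_state a m) + 1 \<and>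
    greedy_run (carry_value (carry_state a m) (tail_value a m)) n'
      (carry_value (carry_state a (Suc m)) ?z) (emitted (carry_state a m) (a (Suc m)))"
  proof (cases "carry_state a m")
    case Lead
    then show ?thesis using b
    proof (elim disjE)
      assume "a (Suc m) = 1"
      moreover from this have "greedy_run (tail_value a m) 1 ?z 1"
        using greedy_run_one_digit[of "(1 + ?z) / \<beta>"] z unfolding tail_value_Suc[of m] by (simp add: divide_right_mono)
      ultimately show ?thesis using Lead by (intro exI[of _ 1]) simp
    qed (use tail_value_Suc[of m] greedy_run_0 in \<open>simp\<close>)
  next
    case (Even k)
    show ?thesis using b
    proof (elim disjE)
      assume "a (Suc m) = 0"
      then show ?thesis using Even greedy_run_alternating[OF z1, of k] tail_value_Suc[of m]
        by (intro exI[of _ "2 * k + 1"]) simp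
    qed (use Even tail_value_Suc[of m] greedy_run_0 in \<open>simp\<close>)
  next
    case (Odd k)
    show ?thesis using b
    proof (elim disjE)
      assume "a (Suc m) = 1"
      then show ?thesis using Odd greedy_run_carry[OF z, of k] tail_value_Suc[of m]
        by (intro exI[of _ "2 * k + 2"]) simp
    qed (use Odd tail_value_Suc[of m] greedy_run_0 alternating_snoc[of k ?z] in \<open>simp\<close>)
  qed
  then obtain n' where n': "n' + held (carry_state a (Suc m)) = held (carry_state a m) + 1" and
    run': "greedy_run (carry_value (carry_state a m) (tail_value a m)) n'
      (carry_value (carry_state a (Suc m)) ?z) (emitted (carry_state a m) (a (Suc m)))" by blast
  show ?case
  proof (intro exI conjI)
    show "n + n' + held (carry_state a (Suc m)) = Suc m" using n n' by linarith
    show "greedy_run (expansion_value a) (n + n') (carry_value (carry_state a (Suc m)) ?z)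
       (\<Sum>i<Suc m. emitted (carry_state a i) (a (Suc i)))"
      using greedy_run_add[OF run run'] by simp
  qed
qed

text \<open>The first \<open>m\<close> greedy digits consist of the released ones and at most as
  many further ones as are withheld.\<close>

lemma greedy_digit_sum_close:
  assumes zeros: "\<And>m. \<exists>j. a (Suc (m + j)) = 0"
  shows "\<bar>(\<Sum>k=1..m. real (greedy_digit (expansion_value a) k))
      - (\<Sum>i<m. real (emitted (carry_state a i) (a (Suc i))))\<bar> \<le> real (held (carry_state a m))"
proof -
  obtain n where n: "n + held (carry_state a m) = m" and
    run: "greedy_run (expansion_value a) n (carry_value (carry_state a m) (tail_value a m))
       (\<Sum>i<m. emitted (carry_state a i) (a (Suc i)))" using greedy_run_transducer[OF zeros] by blast
  let ?d = "greedy_digit (expansion_value a)"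
  have "(\<Sum>k=1..m. ?d k) = (\<Sum>k=1..n. ?d k) + (\<Sum>k=n+1..n + held (carry_state a m). ?d k)"
    using n sum.ub_add_nat[of 1 n ?d "held (carry_state a m)"] by simp
  moreover have "(\<Sum>k=n+1..n + held (carry_state a m). ?d k) \<le> (\<Sum>k=n+1..n + held (carry_state a m). 1)"
    by (intro sum_mono) (simp add: greedy_digit_def)
  moreover have "(\<Sum>k=1..n. ?d k) = (\<Sum>i<m. emitted (carry_state a i) (a (Suc i)))"
    using run by (simp add: greedy_run_def)
  ultimately have "(\<Sum>i<m. emitted (carry_state a i) (a (Suc i))) \<le> (\<Sum>k=1..m. ?d k)"
     "(\<Sum>k=1..m. ?d k) \<le> (\<Sum>i<m. emitted (carry_state a i) (a (Suc i))) + held (carry_state a m)" by simp_all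
  then have "real (\<Sum>i<m. emitted (carry_state a i) (a (Suc i))) \<le> real (\<Sum>k=1..m. ?d k)"
     "real (\<Sum>k=1..m. ?d k) \<le> real (\<Sum>i<m. emitted (carry_state a i) (a (Suc i))) + real (held (carry_state a m))"
    by linarith+
  then show ?thesis by simp
qed

end

section \<open>Digit frequencies\<close>

primrec even_ind :: "carry \<Rightarrow> real" where
  "even_ind Lead = 0" | "even_ind (Even k) = 1" | "even_ind (Odd k) = 0"

primrec odd_ind :: "carry \<Rightarrow> real" where
  "odd_ind Lead = 0" | "odd_ind (Even k) = 0" | "odd_ind (Odd k) = 1"

primrec lead_ind :: "carry \<Rightarrow> real" where
  "lead_ind Lead = 1" | "lead_ind (Even k) = 0" | "lead_ind (Odd k) = 0"

primrec even_len :: "carry \<Rightarrow> real" where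
  "even_len Lead = 0" | "even_len (Even k) = real k" | "even_len (Odd k) = 0"

primrec odd_len :: "carry \<Rightarrow> real" where
  "odd_len Lead = 0" | "odd_len (Even k) = 0" | "odd_len (Odd k) = real k"

text \<open>A finite range at each time makes every function of the state integrable and gives the
  linear bound that \<open>predictable_lln\<close> asks for.\<close>

definition reachable :: "nat \<Rightarrow> carry set" where
  "reachable m = insert Lead (Even ` {..m} \<union> Odd ` {..m})"

lemma carry_state_reachable: "carry_state a m \<in> reachable m"
  by (induction m) (auto simp: reachable_def)

lemma measurable_carry_state [measurable]: "(\<lambda>a. carry_state a m) \<in> coin_measure \<rightarrow>\<^sub>M count_space UNIV"
proof (induction m)
  case (Suc m)
  note [measurable] = Suc
  have "(\<lambda>a. carry_step (carry_state a m) (a (Suc m))) \<in> coin_measure \<rightarrow>\<^sub>M count_space UNIV"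
    by measurable
  then show ?case by simp
qed simp

lemma measurable_carry_fun [measurable]: "(\<lambda>a. \<phi> (carry_state a m) :: real) \<in> borel_measurable coin_measure"
  by measurable

lemma determined_carry_state: "determined m (\<lambda>a. \<phi> (carry_state a m))"
proof -
  have "n > m \<longrightarrow> carry_state (flip_coin n a) m = carry_state a m" for n a
    by (induction m) (auto simp: flip_coin_def)
  then show ?thesis by (simp add: determined_def)
qed

lemma integrable_carry_fun:
  "integrable coin_measure (\<lambda>a. \<phi> (carry_state a m) :: real)"
proof (rule coin_integrable_bounded)
  fix a
  have "finite (reachable m)" by (simp add: reachable_def)
  then show "\<bar>\<phi> (carry_state a m)\<bar> \<le> (\<Sum>s\<in>reachable m. \<bar>\<phi> s\<bar>)"
    using carry_state_reachable[of a m] by (intro member_le_sum) auto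
qed measurable

text \<open>The Markov property: the new value is the average over both digits plus a predictable
  multiple of the coin sign, which has mean zero.\<close>

lemma expectation_carry_step:
  fixes \<phi> :: "carry \<Rightarrow> real"
  shows
  "coin.expectation (\<lambda>a. \<phi> (carry_state a (Suc m)))
     = coin.expectation (\<lambda>a. (\<phi> (carry_step (carry_state a m) 0) + \<phi> (carry_step (carry_state a m) 1)) / 2)"
proof -
  define \<psi> where "\<psi> s = (\<phi> (carry_step s 1) - \<phi> (carry_step s 0)) / 2" for s
  define avg where "avg s = (\<phi> (carry_step s 0) + \<phi> (carry_step s 1)) / 2" for s
  have int: "integrable coin_measure (\<lambda>a. \<psi> (carry_state a m) * coin_sign a (Suc m))"
  proof (rule Bochner_Integration.integrable_bound[OF integrable_carry_fun[of \<psi> m]])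
    show "AE a in coin_measure. norm (\<psi> (carry_state a m) * coin_sign a (Suc m)) \<le> norm (\<psi> (carry_state a m))"
      using coin_cases[of _ "Suc m"] by (intro AE_I2) (fastforce simp: coin_sign_def abs_mult)
  qed measurable
  have "coin.expectation (\<lambda>a. \<phi> (carry_state a (Suc m)))
      = coin.expectation (\<lambda>a. avg (carry_state a m) + \<psi> (carry_state a m) * coin_sign a (Suc m))"
  proof (intro Bochner_Integration.integral_cong refl)
    fix a assume "a \<in> space coin_measure"
    then show "\<phi> (carry_state a (Suc m)) = avg (carry_state a m) + \<psi> (carry_state a m) * coin_sign a (Suc m)"
      using coin_cases[of a "Suc m"] by (auto simp: coin_sign_def avg_def \<psi>_def field_simps)
  qed
  also have "\<dots> = coin.expectation (\<lambda>a. avg (carry_state a m))"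
    using int integrable_carry_fun[of avg m]
      expectation_predictable_sign[OF measurable_carry_fun determined_carry_state, of \<psi> m] by simp
  finally show ?thesis by (simp add: avg_def)
qed

text \<open>The factor \<open>3/2\<close> makes the expected drift contracting from both kinds of states: an odd
  state may increase \<open>k\<close>, but an even state is left for \<open>Even 0\<close> with probability \<open>1/2\<close>.\<close>

primrec lyapunov :: "carry \<Rightarrow> real" where
  "lyapunov Lead = 1"
| "lyapunov (Even k) = (real k + 1) ^ 4"
| "lyapunov (Odd k) = 3 / 2 * (real k + 1) ^ 4"

text \<open>From \<open>Even k\<close> the average is 3/4 (k+1)^4 + 1/2, which dictates the factor
  3/4; the constant 1000 absorbs small \<open>k\<close> in odd states.\<close>

lemma lyapunov_drift:
  "(lyapunov (carry_step s 0) + lyapunov (carry_step s 1)) / 2 \<le> 3 / 4 * lyapunov s + 1000"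
proof (cases s)
  case (Odd k)
  \<comment> \<open>This is twice the required inequality. For k at least 4 the ratio (k+2)/(k+1) is
    at most 6/5, and (6/5)^4 < 9/4.\<close>
  have "(real k + 2) ^ 4 \<le> 9 / 4 * (real k + 1) ^ 4 + 1999"
  proof (cases "k \<ge> 4")
    case True
    then have "(real k + 2) ^ 4 \<le> (6 / 5 * (real k + 1)) ^ 4" by (intro power_mono) auto
    also have "\<dots> = 1296 / 625 * (real k + 1) ^ 4" unfolding power_mult_distrib by (simp add: power_divide)
    also have "\<dots> \<le> 9 / 4 * (real k + 1) ^ 4" by (intro mult_right_mono) auto
    finally show ?thesis by simp
  next
    case False
    then have "(real k + 2) ^ 4 \<le> 6 ^ 4" by (intro power_mono) auto
    then show ?thesis by (simp add: add_increasing)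
  qed
  then have "((2 + real k) ^ 4 + 1) / 2 \<le> 9 / 8 * (1 + real k) ^ 4 + 1000" by (simp add: add.commute)
  with Odd show ?thesis by (simp add: add.commute)
qed (auto simp: field_simps)

text \<open>4000 is the fixed point of \<open>t \<mapsto> 3/4 * t + 1000\<close>, and the chain
  starts below it.\<close>

lemma expectation_lyapunov: "coin.expectation (\<lambda>a. lyapunov (carry_state a m)) \<le> 4000"
proof (induction m)
  case (Suc m)
  have "coin.expectation (\<lambda>a. lyapunov (carry_state a (Suc m)))
      \<le> coin.expectation (\<lambda>a. 3 / 4 * lyapunov (carry_state a m) + 1000)"
    unfolding expectation_carry_step[of lyapunov]
    by (intro integral_mono lyapunov_drift integrable_carry_fun[of "\<lambda>s. (lyapunov (carry_step s 0) + lyapunov (carry_step s 1)) / 2"]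
        integrable_carry_fun[of "\<lambda>s. 3 / 4 * lyapunov s + 1000"])
  also have "\<dots> = 3 / 4 * coin.expectation (\<lambda>a. lyapunov (carry_state a m)) + 1000"
    using integrable_carry_fun[of lyapunov m] by (simp add: coin.prob_space)
  finally show ?case using Suc by simp
qed (simp add: coin.prob_space)

text \<open>A common majorant of the functionals to be averaged, with fourth power below
  \<open>lyapunov\<close>.\<close>

primrec weight :: "carry \<Rightarrow> real" where
  "weight Lead = 1" | "weight (Even k) = real k + 1" | "weight (Odd k) = real k + 1"

lemma weight_pow4_le_lyapunov: "weight s ^ 4 \<le> lyapunov s"
  by (cases s) auto

lemma weight_reachable: "s \<in> reachable m \<Longrightarrow> weight s \<le> real m + 1"
  by (auto simp: reachable_def)

lemma carry_lln:
  assumes w: "\<And>s. \<bar>\<phi> s\<bar> \<le> weight s"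
  shows "AE a in coin_measure. (\<lambda>n. (\<Sum>m<n. \<phi> (carry_state a m) * coin_sign a (Suc m)) / real n) \<longlonglongrightarrow> 0"
proof (rule predictable_lln)
  show "coin.expectation (\<lambda>a. \<phi> (carry_state a m) ^ 4) \<le> 4000" for m
  proof (rule order_trans[OF integral_mono expectation_lyapunov])
    show "\<phi> (carry_state a m) ^ 4 \<le> lyapunov (carry_state a m)" for a
      using power_mono[OF w abs_ge_zero, of "carry_state a m" 4] weight_pow4_le_lyapunov[of "carry_state a m"] by simp
  qed (rule integrable_carry_fun[of "\<lambda>s. \<phi> s ^ 4"] integrable_carry_fun)+
  show "\<bar>\<phi> (carry_state a m)\<bar> \<le> real m + 1" for a m
    by (rule order_trans[OF w weight_reachable[OF carry_state_reachable]])
qed (simp_all add: determined_carry_state)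

text \<open>The fourth moment of the withheld length is at most 16 * 4000, so the fourth moments of
  the quotients are summable.\<close>

lemma held_sublinear: "AE a in coin_measure. (\<lambda>n. real (held (carry_state a n)) / real n) \<longlonglongrightarrow> 0"
proof -
  have held: "real (held s) ^ 4 \<le> 16 * lyapunov s" for s
  proof (cases s)
    case (Even k)
    have "real (2 * k + 1) ^ 4 \<le> (2 * (real k + 1)) ^ 4" by (rule power_mono) auto
    also have "\<dots> = 16 * (real k + 1) ^ 4" unfolding power_mult_distrib by simp
    finally show ?thesis using Even by simp
  next
    case (Odd k)
    have "real (2 * k + 2) ^ 4 \<le> (2 * (real k + 1)) ^ 4" by (rule power_mono) auto
    also have "\<dots> \<le> 24 * (real k + 1) ^ 4" unfolding power_mult_distrib by simp
    finally show ?thesis using Odd by simp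
  qed simp
  let ?f = "\<lambda>n s. (real (held s) / real n) ^ 4"
  have "AE a in coin_measure. (\<lambda>n. ?f n (carry_state a n)) \<longlonglongrightarrow> 0"
  proof (rule summable_expectation_imp_tendsto_zero)
    have sm: "summable (\<lambda>n. 64000 * (1 / real n ^ 4))"
      using inverse_power_summable[of 4, where 'a=real] by (intro summable_mult) (simp add: field_simps)
    show "summable (\<lambda>n. coin.expectation (\<lambda>a. ?f n (carry_state a n)))"
    proof (rule summable_comparison_test'[OF sm, of 0])
      fix n :: nat
      have "coin.expectation (\<lambda>a. ?f n (carry_state a n)) \<le> coin.expectation (\<lambda>a. 16 / real n ^ 4 * lyapunov (carry_state a n))"
      proof (rule integral_mono)
        show "?f n (carry_state a n) \<le> 16 / real n ^ 4 * lyapunov (carry_state a n)" for a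
          using divide_right_mono[OF held[of "carry_state a n"], of "real n ^ 4"] by (simp add: power_divide)
      qed (rule integrable_carry_fun[of "?f n"] integrable_carry_fun[of "\<lambda>s. 16 / real n ^ 4 * lyapunov s"])+
      also have "\<dots> = 16 / real n ^ 4 * coin.expectation (\<lambda>a. lyapunov (carry_state a n))" by simp
      also have "\<dots> \<le> 16 / real n ^ 4 * 4000" by (intro mult_left_mono expectation_lyapunov) auto
      finally show "norm (coin.expectation (\<lambda>a. ?f n (carry_state a n))) \<le> 64000 * (1 / real n ^ 4)"
        by (simp add: Bochner_Integration.integral_nonneg)
    qed
  qed (auto intro: integrable_carry_fun[of "?f _"])
  then show ?thesis by eventually_elim (rule tendsto_zero_of_power4)
qed

section \<open>Counting the released ones\<close>

lemma sum_carry_shift: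
  assumes "\<phi> Lead = (0 :: real)"
  shows "(\<Sum>m<n. \<phi> (carry_state a (Suc m))) = (\<Sum>m<n. \<phi> (carry_state a m)) + \<phi> (carry_state a n)"
  \<comment> \<open>The chain starts in \<open>Lead\<close>, where \<phi> vanishes, so only the
    upper boundary term remains.\<close>
  using assms by (induction n) auto

text \<open>Summing the one-step transition rules gives linear equations between the sums of
  \<^const>\<open>even_ind\<close>, \<^const>\<open>odd_ind\<close>, \<^const>\<open>even_len\<close> and \<^const>\<open>odd_len\<close> along the run, up
  to the noise terms \<open>M\<close> and boundary terms; this is their solution.\<close>

lemma emitted_sum:
  fixes a :: "nat \<Rightarrow> nat" and n :: nat
  assumes a: "a \<in> space coin_measure"
  defines "s \<equiv> carry_state a"
  defines "M \<equiv> \<lambda>\<phi>. \<Sum>m<n. \<phi> (s m) * coin_sign a (Suc m)"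
  shows "(\<Sum>m<n. real (emitted (s m) (a (Suc m))))
     = 5 / 18 * real n - 5 / 18 * (\<Sum>m<n. lead_ind (s m)) + (\<Sum>m<n. lead_ind (s m) * real (a (Suc m)))
       + 5 / 18 * M even_ind - 1 / 3 * M (\<lambda>s. odd_len s + odd_ind s) - 1 / 3 * M even_len + 1 / 2 * M odd_ind
       - 5 / 9 * odd_ind (s n) - 1 / 3 * odd_len (s n) - 2 / 3 * even_len (s n)"
proof -
  define A where "A \<phi> = (\<Sum>m<n. \<phi> (s m))" for \<phi> :: "carry \<Rightarrow> real"
  define W where "W = (\<Sum>m<n. lead_ind (s m) * real (a (Suc m)))"
  have s_Suc: "s (Suc m) = carry_step (s m) (a (Suc m))" for m by (simp add: s_def)
  have b: "a (Suc m) = 0 \<and> coin_sign a (Suc m) = - 1 \<or> a (Suc m) = 1 \<and> coin_sign a (Suc m) = 1" for m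
    using coin_cases[OF a, of "Suc m"] by (auto simp: coin_sign_def)
  \<comment> \<open>Reading 1 or 0 has indicator (1 + sign)/2 or (1 - sign)/2; this splits each
    transition rule into mean and noise.\<close>
  have q: "odd_ind (s (Suc m)) = even_ind (s m) / 2 + even_ind (s m) * coin_sign a (Suc m) / 2" for m
    using b[of m] by (cases "s m") (auto simp: s_Suc field_simps)
  \<comment> \<open>\<open>odd_len + odd_ind\<close> is k+1 at \<open>Odd k\<close>, the new index
    after reading 0.\<close>
  have u: "even_len (s (Suc m)) = (odd_len (s m) + odd_ind (s m)) / 2 - (odd_len (s m) + odd_ind (s m)) * coin_sign a (Suc m) / 2" for m
    using b[of m] by (cases "s m") (auto simp: s_Suc field_simps)
  have v: "odd_len (s (Suc m)) = even_len (s m) / 2 + even_len (s m) * coin_sign a (Suc m) / 2" for m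
    using b[of m] by (cases "s m") (auto simp: s_Suc field_simps)
  have g: "real (emitted (s m) (a (Suc m))) = even_len (s m) / 2 - even_len (s m) * coin_sign a (Suc m) / 2
      + odd_ind (s m) / 2 + odd_ind (s m) * coin_sign a (Suc m) / 2 + lead_ind (s m) * real (a (Suc m))" for m
    using b[of m] by (cases "s m") auto
  have one: "even_ind (s m) + odd_ind (s m) + lead_ind (s m) = 1" for m by (cases "s m") auto
  \<comment> \<open>Without noise, boundary and \<open>Lead\<close> terms the system gives
    \<open>A odd_ind = n/3\<close> and \<open>A even_len = 2n/9\<close>, hence n/9 + n/6 = 5n/18
    ones.\<close>
  have "A odd_ind + odd_ind (s n) = A even_ind / 2 + M even_ind / 2"
    using sum_carry_shift[of odd_ind a n] q unfolding A_def M_def s_def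
    by (simp add: sum.distrib sum_divide_distrib)
  moreover have "A even_len + even_len (s n) = A (\<lambda>s. odd_len s + odd_ind s) / 2 - M (\<lambda>s. odd_len s + odd_ind s) / 2"
    using sum_carry_shift[of even_len a n] u unfolding A_def M_def s_def
    by (simp only: sum_subtractf sum_divide_distrib even_len.simps)
  moreover have "A (\<lambda>s. odd_len s + odd_ind s) = A odd_len + A odd_ind"
    unfolding A_def by (rule sum.distrib)
  moreover have "A odd_len + odd_len (s n) = A even_len / 2 + M even_len / 2"
    using sum_carry_shift[of odd_len a n] v unfolding A_def M_def s_def
    by (simp add: sum.distrib sum_divide_distrib)
  moreover have "A even_ind + A odd_ind + A lead_ind = real n"
    using one unfolding A_def by (simp add: sum.distrib[symmetric])
  moreover have "(\<Sum>m<n. real (emitted (s m) (a (Suc m)))) = A even_len / 2 - M even_len / 2 + A odd_ind / 2 + M odd_ind / 2 + W"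
    unfolding g A_def M_def W_def by (simp add: sum.distrib sum_divide_distrib sum_subtractf)
  ultimately show ?thesis unfolding A_def[symmetric] W_def[symmetric] by argo
qed

lemma held_bounds: "odd_ind s \<in> {0..real (held s)}" "odd_len s \<in> {0..real (held s)}" "even_len s \<in> {0..real (held s)}"
  by (cases s; simp)+

text \<open>The first 0 leaves \<open>Lead\<close>, and no transition returns to it.\<close>

lemma lead_eventually_zero: "a (Suc j) = 0 \<Longrightarrow> m > j \<Longrightarrow> lead_ind (carry_state a m) = 0"
proof (induction m)
  case (Suc m)
  show ?case
  proof (cases "m = j")
    case True
    then show ?thesis using Suc.prems by (cases "carry_state a j") auto
  next
    case False
    then show ?thesis using Suc by (cases "carry_state a m") auto
  qed
qed simp

lemma bounded_sum_average_zero: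
  fixes f :: "nat \<Rightarrow> real"
  assumes "\<And>m. m > j \<Longrightarrow> f m = 0"
  shows "(\<lambda>n. (\<Sum>m<n. f m) / real n) \<longlonglongrightarrow> 0"
proof -
  have "(\<lambda>n. (\<Sum>m\<le>j. f m) / real n) \<longlonglongrightarrow> 0" by (rule lim_const_over_n)
  moreover have "\<forall>\<^sub>F n in sequentially. (\<Sum>m\<le>j. f m) / real n = (\<Sum>m<n. f m) / real n"
    using eventually_gt_at_top[of j]
  proof eventually_elim
    case (elim n)
    then have "(\<Sum>m<n. f m) = (\<Sum>m\<le>j. f m)" using assms by (intro sum.mono_neutral_right) auto
    then show ?case by simp
  qed
  ultimately show ?thesis by (rule Lim_transform_eventually)
qed

lemma zeros_recur:
  assumes a: "a \<in> space coin_measure"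
    and lim: "(\<lambda>n. (\<Sum>m<n. coin_sign a (Suc m)) / real n) \<longlonglongrightarrow> 0"
  shows "\<exists>j. a (Suc (m + j)) = 0"
proof (rule ccontr)
  assume "\<nexists>j. a (Suc (m + j)) = 0"
  then have one: "a (Suc i) = 1" if "i \<ge> m" for i
  proof -
    from that obtain n where "i = m + n" using le_Suc_ex by blast
    moreover have "a (Suc (m + n)) \<noteq> 0" using \<open>\<nexists>j. a (Suc (m + j)) = 0\<close> by simp
    ultimately have "a (Suc i) \<noteq> 0" by simp
    then show ?thesis using coin_cases[OF a, of "Suc i"] by simp
  qed
  \<comment> \<open>With only ones from \<open>m\<close> on, the signs have average 1 instead of
    0.\<close>
  have "(\<lambda>n. (\<Sum>i<n. coin_sign a (Suc i) - 1) / real n) \<longlonglongrightarrow> 0"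
    by (rule bounded_sum_average_zero[of m]) (simp add: coin_sign_def one)
  from tendsto_diff[OF lim this] have "(\<lambda>n. real n / real n) \<longlonglongrightarrow> 0"
    by (simp add: sum_subtractf diff_divide_distrib)
  moreover have "(\<lambda>n. real n / real n) \<longlonglongrightarrow> 1"
    by (rule tendsto_eventually) (use eventually_gt_at_top[of 0] in eventually_elim, simp)
  ultimately show False using LIMSEQ_unique by fastforce
qed

lemma greedy_frequency_coin:
  "AE a in coin_measure.
     (\<lambda>n. (\<Sum>k=1..n. real (greedy_digit (expansion_value a) k)) / real n) \<longlonglongrightarrow> 5 / 18"
proof -
  let ?av = "\<lambda>\<phi> a n. (\<Sum>m<n. \<phi> (carry_state a m) * coin_sign a (Suc m)) / real n"
  have w: "\<bar>even_ind s\<bar> \<le> weight s" "\<bar>odd_ind s\<bar> \<le> weight s" "\<bar>even_len s\<bar> \<le> weight s"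
    "\<bar>odd_len s + odd_ind s\<bar> \<le> weight s" "\<bar>1\<bar> \<le> weight s" for s
    by (cases s; simp)+
  \<comment> \<open>The constant functional gives the ordinary strong law, from which zeros
    recur.\<close>
  have "AE a in coin_measure. ?av (\<lambda>_. 1) a \<longlonglongrightarrow> 0" by (rule carry_lln) (rule w)
  moreover have "AE a in coin_measure. ?av even_ind a \<longlonglongrightarrow> 0" by (rule carry_lln) (rule w)
  moreover have "AE a in coin_measure. ?av odd_ind a \<longlonglongrightarrow> 0" by (rule carry_lln) (rule w)
  moreover have "AE a in coin_measure. ?av even_len a \<longlonglongrightarrow> 0" by (rule carry_lln) (rule w)
  moreover have "AE a in coin_measure. ?av (\<lambda>s. odd_len s + odd_ind s) a \<longlonglongrightarrow> 0" by (rule carry_lln) (rule w)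
  ultimately show ?thesis using held_sublinear AE_space
  proof eventually_elim
    case (elim a)
    note a = elim(7)
    have zeros: "\<exists>j. a (Suc (m + j)) = 0" for m using zeros_recur[OF a] elim(1) by simp
    obtain j where j: "a (Suc j) = 0" using zeros[of 0] by auto
    let ?s = "carry_state a"
    have l1: "(\<lambda>n. (\<Sum>m<n. lead_ind (?s m)) / real n) \<longlonglongrightarrow> 0"
      by (rule bounded_sum_average_zero[of j]) (rule lead_eventually_zero[of a j, OF j])
    have l2: "(\<lambda>n. (\<Sum>m<n. lead_ind (?s m) * real (a (Suc m))) / real n) \<longlonglongrightarrow> 0"
      by (rule bounded_sum_average_zero[of j]) (simp add: lead_eventually_zero[of a j, OF j])
    have st: "(\<lambda>n. \<phi> (?s n) / real n) \<longlonglongrightarrow> 0" if "\<And>s. \<phi> s \<in> {0..real (held s)}" for \<phi>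
      by (rule tendsto_sandwich[OF _ _ tendsto_const elim(6)])
        (use that in \<open>auto intro!: always_eventually divide_right_mono\<close>)
    let ?G = "\<lambda>n. \<Sum>i<n. real (emitted (?s i) (a (Suc i)))"
    let ?D = "\<lambda>n. \<Sum>k=1..n. real (greedy_digit (expansion_value a) k)"
    have "(\<lambda>n. 5 / 18 - 5 / 18 * ((\<Sum>m<n. lead_ind (?s m)) / real n)
        + (\<Sum>m<n. lead_ind (?s m) * real (a (Suc m))) / real n
        + 5 / 18 * ?av even_ind a n - 1 / 3 * ?av (\<lambda>s. odd_len s + odd_ind s) a n
        - 1 / 3 * ?av even_len a n + 1 / 2 * ?av odd_ind a n
        - 5 / 9 * (odd_ind (?s n) / real n) - 1 / 3 * (odd_len (?s n) / real n) - 2 / 3 * (even_len (?s n) / real n))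
      \<longlonglongrightarrow> 5 / 18 - 5 / 18 * 0 + 0 + 5 / 18 * 0 - 1 / 3 * 0 - 1 / 3 * 0 + 1 / 2 * 0 - 5 / 9 * 0 - 1 / 3 * 0 - 2 / 3 * 0"
      (is "?F \<longlonglongrightarrow> _")
      by (intro tendsto_add tendsto_diff tendsto_mult_left tendsto_const l1 l2 elim st held_bounds)
    then have F: "?F \<longlonglongrightarrow> 5 / 18" by simp
    have "\<forall>\<^sub>F n in sequentially. ?F n = ?G n / real n"
      using eventually_gt_at_top[of 0]
      by eventually_elim (simp add: emitted_sum[OF a] add_divide_distrib diff_divide_distrib)
    from Lim_transform_eventually[OF F this] have "(\<lambda>n. ?G n / real n) \<longlonglongrightarrow> 5 / 18" .
    moreover have "(\<lambda>n. ?D n / real n - ?G n / real n) \<longlonglongrightarrow> 0"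
    proof (rule Lim_null_comparison[OF always_eventually elim(6)], rule allI)
      fix n
      have "\<bar>?D n - ?G n\<bar> / real n \<le> real (held (?s n)) / real n"
        by (intro divide_right_mono greedy_digit_sum_close[OF a zeros]) simp
      then show "norm (?D n / real n - ?G n / real n) \<le> real (held (?s n)) / real n"
        by (simp add: diff_divide_distrib[symmetric])
    qed
    ultimately have "(\<lambda>n. ?G n / real n + (?D n / real n - ?G n / real n)) \<longlonglongrightarrow> 5 / 18 + 0"
      by (rule tendsto_add)
    then show ?case by simp
  qed
qed

section \<open>Transfer to the Bernoulli convolution\<close>

lemma measurable_expansion_value: "expansion_value \<in> coin_measure \<rightarrow>\<^sub>M borel_I\<^sub>\<beta>"
proof (rule measurable_restrict_space2)
  show "expansion_value \<in> space coin_measure \<rightarrow> I\<^sub>\<beta>"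
    using tail_value_bounds[of _ 0] by (auto simp: I_eq tail_value_def)
  show "expansion_value \<in> borel_measurable coin_measure"
    unfolding expansion_value_def[abs_def] by measurable
qed

lemma measurable_greedy_digit [measurable]: "(\<lambda>x. real (greedy_digit x k)) \<in> borel_measurable borel"
  unfolding greedy_digit_def by measurable

text \<open>\<open>AE_distr_iff\<close> asks for a measurable event; tolerances 1/(j+1) make the
  quantifiers countable.\<close>

lemma sets_LIMSEQ:
  fixes F :: "nat \<Rightarrow> 'a \<Rightarrow> real"
  assumes [measurable]: "\<And>n. F n \<in> borel_measurable M"
  shows "{x \<in> space M. (\<lambda>n. F n x) \<longlonglongrightarrow> c} \<in> sets M"
proof -
  have "(\<lambda>n. F n x) \<longlonglongrightarrow> c \<longleftrightarrow> (\<forall>j. \<exists>N. \<forall>n\<ge>N. \<bar>F n x - c\<bar> < inverse (real (Suc j)))" for x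
  proof
    assume lim: "(\<lambda>n. F n x) \<longlonglongrightarrow> c"
    show "\<forall>j. \<exists>N. \<forall>n\<ge>N. \<bar>F n x - c\<bar> < inverse (real (Suc j))"
    proof
      fix j show "\<exists>N. \<forall>n\<ge>N. \<bar>F n x - c\<bar> < inverse (real (Suc j))"
        using LIMSEQ_D[OF lim, of "inverse (real (Suc j))"] by simp
    qed
  next
    assume *: "\<forall>j. \<exists>N. \<forall>n\<ge>N. \<bar>F n x - c\<bar> < inverse (real (Suc j))"
    show "(\<lambda>n. F n x) \<longlonglongrightarrow> c"
    proof (rule LIMSEQ_I)
      fix r :: real assume "r > 0"
      then obtain j where "inverse (real (Suc j)) < r" using reals_Archimedean by blast
      with * show "\<exists>N. \<forall>n\<ge>N. norm (F n x - c) < r" by (force intro: less_trans)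
    qed
  qed
  then show ?thesis by simp
qed

lemma greedy_frequency:
  "AE x in bernoulli_convolution. (\<lambda>n. (\<Sum>k=1..n. real (greedy_digit x k)) / real n) \<longlonglongrightarrow> 5 / 18"
proof -
  have "(\<lambda>x. (\<Sum>k=1..n. real (greedy_digit x k)) / real n) \<in> borel_measurable borel_I\<^sub>\<beta>" for n
    by (intro measurable_restrict_space1) measurable
  then show ?thesis
    unfolding bernoulli_convolution_def using greedy_frequency_coin
    by (subst AE_distr_iff[OF measurable_expansion_value sets_LIMSEQ])
qed

theorem theorem1p2:
  "(AE x in bernoulli_convolution.
      (\<lambda>n. (\<Sum>k=1..n. real (greedy_digit x k)) / real n) \<longlonglongrightarrow> 5 / 18)
   \<and> 5 / 18 > \<alpha>\<^sub>1"
  using greedy_frequency \<alpha>\<^sub>1_less by blast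

end
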